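(* If $X$ is a paracompact Hausdorff space and $B \subseteq X$ is a closed subspace that is locally collared in $X$, then $B$ is collared in $X$.
   Context: Let $X$ be a topological space and $B\subseteq X$ a closed subset with the subspace topology. An embedding is a homeomorphism onto its image. A local collar of $B$ in $X$ is an embedding $c : \overline{U} \times [0,1] \to X$, where $U$ is a relatively open subset of $B$, such that $c(x,0)=x$ for all $x \in \overline{U}$, such that $c^{-1}(B) = \overline{U}\times\{0\}$, and such that $c(U\times[0,1))$ is open in $X$. A local collar of the form $c : B\times[0,1]\to X$ (that is, with $U=B$) is called a collar of $B$ in $X$. $B$ is collared in $X$ if it has a collar in $X$. $B$ is locally collared in $X$ if every $x\in B$ has a relatively open neighborhood $U\subseteq B$ such that there exists a local collar $c:\overline{U}\times[0,1]\to X$ of $B$ in $X$. *)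

theory Defs
  imports "HOL-Analysis.Analysis"
begin

text \<open>The Hausdorff property is not part of this definition.\<close>

definition paracompact_space :: "'a topology \<Rightarrow> bool" where
  "paracompact_space X \<longleftrightarrow>
     (\<forall>\<U>. (\<forall>U\<in>\<U>. openin X U) \<and> \<Union>\<U> = topspace X \<longrightarrow>
        (\<exists>\<V>. (\<forall>V\<in>\<V>. openin X V) \<and> \<Union>\<V> = topspace X \<and>
             (\<forall>V\<in>\<V>. \<exists>U\<in>\<U>. V \<subseteq> U) \<and> locally_finite_in X \<V>))"

text \<open>The notions below are meant for a closed subset \<open>B\<close> of \<open>X\<close>; then the closure of
  \<open>U \<subseteq> B\<close> in \<open>X\<close> is also its closure in \<open>B\<close>.\<close>

definition local_collar ::
    "'a topology \<Rightarrow> 'a set \<Rightarrow> 'a set \<Rightarrow> ('a \<times> real \<Rightarrow> 'a) \<Rightarrow> bool" where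
  "local_collar X B U c \<longleftrightarrow>
     openin (subtopology X B) U \<and>
     embedding_map
       (prod_topology (subtopology X (X closure_of U)) (top_of_set {0..1})) X c \<and>
     (\<forall>x \<in> X closure_of U. c (x, 0) = x) \<and>
     {p \<in> (X closure_of U) \<times> {0..1}. c p \<in> B} = (X closure_of U) \<times> {0} \<and>
     openin X (c ` (U \<times> {0..<1}))"

definition collared :: "'a topology \<Rightarrow> 'a set \<Rightarrow> bool" where
  "collared X B \<longleftrightarrow> (\<exists>c. local_collar X B B c)"

definition locally_collared :: "'a topology \<Rightarrow> 'a set \<Rightarrow> bool" where
  "locally_collared X B \<longleftrightarrow> (\<forall>x\<in>B. \<exists>U c. x \<in> U \<and> local_collar X B U c)"

end

theory Submission
  imports Defs
begin

text \<open>
  The idea, due to Connelly, is to glue an outer collar \<open>B \<times> (-\<infinity>, 0]\<close> to \<open>X\<close> along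
  \<open>B\<close> and to push it into \<open>X\<close> by self-homeomorphisms of the enlarged space \<open>Z\<close>.
  A local collar over \<open>U\<close> continues to the outside and gives an open chart
  \<open>U \<times> (-\<infinity>, 1)\<close> of \<open>Z\<close>. Sliding along its fibres by an amount that fades out before the chart
  ends and towards the boundary of \<open>U\<close> is a homeomorphism of \<open>Z\<close> which far out is
  the translation \<open>(b, s) \<mapsto> (b, s + h b)\<close> for a function \<open>h \<ge> 0\<close>. The amount has to be small
  enough that only points of a prescribed open set of \<open>X\<close> move; the infimum over the fibre in
  \<open>local_collar_push\<close> achieves this.

  If \<open>\<tau>\<^sub>0, \<tau>\<^sub>1, \<dots>\<close> are such pushes with translation functions \<open>h\<^sub>0, h\<^sub>1, \<dots>\<close>, then
  \<open>T\<^sub>n = \<tau>\<^sub>0 \<circ> \<dots> \<circ> \<tau>\<^sub>n\<^sub>-\<^sub>1\<close> translates by \<open>f\<^sub>n = h\<^sub>0 + \<dots> + h\<^sub>n\<^sub>-\<^sub>1\<close>, and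
  \<open>(b, t) \<mapsto> T\<^sub>n (b, t - f\<^sub>n b)\<close> is an open embedding of \<open>{(b, t). t < f\<^sub>n b}\<close> that fixes all
  \<open>(b, t)\<close> with \<open>t \<le> 0\<close>. Since the newest push acts first, while the points concerned are still in
  the range where it is a translation, each of these embeddings extends the previous one. Their union
  is a collar of variable length \<open>\<Sum>n. h\<^sub>n\<close>, and rescaling its fibres gives a collar as soon as at
  every point of \<open>B\<close> some \<open>h\<^sub>n\<close> is positive (\<open>collared_if_pushes\<close>).

  Countably many pushes suffice because pushes with disjoint supports can be carried out at the same
  time (\<open>disjoint_push\<close>), and because an open cover of a paracompact Hausdorff space has a refinement
  that consists of countably many disjoint families (\<open>paracompact_sigma_disjoint_refinement\<close>).
\<close>

section \<open>Separation and disjoint refinements in paracompact spaces\<close>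

text \<open>Refine the cover by \<open>X - C\<close> and the given neighbourhoods to a locally finite one and unite its
  members that meet \<open>C\<close>: by local finiteness the closure of the union is the union of the closures.
  With \<open>D\<close> a point this turns the Hausdorff property into regularity; with \<open>D\<close> closed it turns
  regularity into normality.\<close>
lemma paracompact_separate:
  assumes X: "paracompact_space X" and C: "closedin X C"
    and sep: "\<And>x. x \<in> C \<Longrightarrow> \<exists>W. openin X W \<and> x \<in> W \<and> disjnt D (X closure_of W)"
  obtains W where "openin X W" "C \<subseteq> W" "disjnt D (X closure_of W)"
proof -
  define \<U> where "\<U> = insert (topspace X - C) {W. openin X W \<and> disjnt D (X closure_of W)}"
  have op: "\<And>U. U \<in> \<U> \<Longrightarrow> openin X U"
    using C by (auto simp: \<U>_def)
  have "\<Union>\<U> = topspace X"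
  proof
    show "\<Union>\<U> \<subseteq> topspace X"
      using op openin_subset by fastforce
    show "topspace X \<subseteq> \<Union>\<U>"
      unfolding \<U>_def using sep by blast
  qed
  with X op obtain \<V> where \<V>: "\<And>V. V \<in> \<V> \<Longrightarrow> openin X V" "\<Union>\<V> = topspace X"
      "\<And>V. V \<in> \<V> \<Longrightarrow> \<exists>U\<in>\<U>. V \<subseteq> U" "locally_finite_in X \<V>"
    unfolding paracompact_space_def by metis
  define \<W> where "\<W> = {V \<in> \<V>. V \<inter> C \<noteq> {}}"
  have lf: "locally_finite_in X \<W>"
    using \<V>(4) by (rule locally_finite_in_subset) (auto simp: \<W>_def)
  have dis: "disjnt D (X closure_of V)" if V: "V \<in> \<W>" for V
  proof -
    obtain U where U: "U \<in> \<U>" "V \<subseteq> U"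
      using V \<V>(3) by (auto simp: \<W>_def)
    then have "disjnt D (X closure_of U)"
      using V by (auto simp: \<W>_def \<U>_def)
    then show ?thesis
      using closure_of_mono[OF U(2), of X] by (auto simp: disjnt_def)
  qed
  show thesis
  proof
    show "openin X (\<Union>\<W>)"
      using \<V>(1) by (auto simp: \<W>_def)
    show "C \<subseteq> \<Union>\<W>"
      using closedin_subset[OF C] \<V>(2) unfolding \<W>_def by blast
    show "disjnt D (X closure_of (\<Union>\<W>))"
      using dis by (auto simp: closure_of_locally_finite_Union[OF lf] disjnt_def)
  qed
qed

lemma paracompact_Hausdorff_imp_regular_space:
  assumes X: "paracompact_space X" and H: "Hausdorff_space X"
  shows "regular_space X"
  unfolding regular_space_def
proof (intro allI impI, elim conjE)
  fix C a
  assume C: "closedin X C" and a: "a \<in> topspace X - C"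
  have "\<exists>W. openin X W \<and> x \<in> W \<and> disjnt {a} (X closure_of W)" if x: "x \<in> C" for x
  proof -
    have "x \<in> topspace X" "x \<noteq> a"
      using closedin_subset[OF C] a x by auto
    then obtain W O' where W: "openin X W" "openin X O'" "x \<in> W" "a \<in> O'" "disjnt W O'"
      using H a unfolding Hausdorff_space_def by blast
    then have "a \<notin> X closure_of W"
      by (auto simp: in_closure_of disjnt_def)
    with W show ?thesis
      by auto
  qed
  then obtain W where W: "openin X W" "C \<subseteq> W" "disjnt {a} (X closure_of W)"
    using paracompact_separate[OF X C, of "{a}"] a by auto
  then show "\<exists>U V. openin X U \<and> openin X V \<and> a \<in> U \<and> C \<subseteq> V \<and> disjnt U V"
    using a closure_of_subset[OF openin_subset[OF W(1)]]
    by (intro exI[of _ "topspace X - X closure_of W"] exI[of _ W]) (auto simp: disjnt_def)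
qed

lemma paracompact_Hausdorff_imp_normal_space:
  assumes X: "paracompact_space X" and H: "Hausdorff_space X"
  shows "normal_space X"
  unfolding normal_space_def
proof (intro allI impI, elim conjE)
  fix C D
  assume C: "closedin X C" and D: "closedin X D" and CD: "disjnt C D"
  have "\<exists>W. openin X W \<and> x \<in> W \<and> disjnt D (X closure_of W)" if "x \<in> C" for x
    using paracompact_Hausdorff_imp_regular_space[OF X H] D CD that closedin_subset[OF C]
    unfolding regular_space disjnt_def by blast
  then obtain W where W: "openin X W" "C \<subseteq> W" "disjnt D (X closure_of W)"
    using paracompact_separate[OF X C, of D] by auto
  then show "\<exists>U V. openin X U \<and> openin X V \<and> C \<subseteq> U \<and> D \<subseteq> V \<and> disjnt U V"
    using closedin_subset[OF D] closure_of_subset[OF openin_subset[OF W(1)]]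
    by (intro exI[of _ "topspace X - X closure_of W"] exI[of _ W]) (auto simp: disjnt_def)
qed

text \<open>A weak form of a partition of unity. Regularity provides a second locally finite cover \<open>\<W>\<close>
  whose members have their closures inside members of \<open>\<V>\<close>. The closures that lie in \<open>V\<close> then
  unite to a closed subset of \<open>V\<close>, and \<open>f V\<close> is a Urysohn function for it.\<close>
lemma paracompact_locally_finite_functions:
  assumes X: "paracompact_space X" and H: "Hausdorff_space X"
    and \<U>: "\<forall>U\<in>\<U>. openin X U" "\<Union>\<U> = topspace X"
  obtains \<V> and f :: "'a set \<Rightarrow> 'a \<Rightarrow> real"
  where "\<And>V. V \<in> \<V> \<Longrightarrow> openin X V" "\<And>V. V \<in> \<V> \<Longrightarrow> \<exists>U\<in>\<U>. V \<subseteq> U" "locally_finite_in X \<V>"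
    "\<And>V. V \<in> \<V> \<Longrightarrow> continuous_map X euclideanreal (f V)"
    "\<And>V x. V \<in> \<V> \<Longrightarrow> x \<in> topspace X - V \<Longrightarrow> f V x = 0"
    "\<And>V x. V \<in> \<V> \<Longrightarrow> x \<in> topspace X \<Longrightarrow> 0 \<le> f V x"
    "\<And>x. x \<in> topspace X \<Longrightarrow> \<exists>V\<in>\<V>. f V x = 1"
proof -
  obtain \<V> where \<V>: "\<And>V. V \<in> \<V> \<Longrightarrow> openin X V" "\<Union>\<V> = topspace X"
      "\<And>V. V \<in> \<V> \<Longrightarrow> \<exists>U\<in>\<U>. V \<subseteq> U" "locally_finite_in X \<V>"
    using X \<U> unfolding paracompact_space_def by metis
  define \<O> where "\<O> = {O'. openin X O' \<and> (\<exists>V\<in>\<V>. X closure_of O' \<subseteq> V)}"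
  have "\<Union>\<O> = topspace X"
  proof
    show "\<Union>\<O> \<subseteq> topspace X"
      using openin_subset by (fastforce simp: \<O>_def)
    show "topspace X \<subseteq> \<Union>\<O>"
    proof
      fix x
      assume x: "x \<in> topspace X"
      then obtain V where V: "V \<in> \<V>" "x \<in> V"
        using \<V>(2) by blast
      then obtain O' where "openin X O'" "x \<in> O'" "disjnt (topspace X - V) (X closure_of O')"
        using paracompact_Hausdorff_imp_regular_space[OF X H] x \<V>(1)[OF V(1)]
        unfolding regular_space by (metis Diff_iff closedin_diff closedin_topspace)
      moreover have "X closure_of O' \<subseteq> topspace X"
        by (rule closure_of_subset_topspace)
      ultimately show "x \<in> \<Union>\<O>"
        using V unfolding \<O>_def disjnt_def by blast
    qed
  qed
  moreover have "\<And>O'. O' \<in> \<O> \<Longrightarrow> openin X O'"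
    by (auto simp: \<O>_def)
  ultimately obtain \<W> where \<W>: "\<And>W. W \<in> \<W> \<Longrightarrow> openin X W" "\<Union>\<W> = topspace X"
      "\<And>W. W \<in> \<W> \<Longrightarrow> \<exists>O'\<in>\<O>. W \<subseteq> O'" "locally_finite_in X \<W>"
    using X unfolding paracompact_space_def by metis
  define C where "C = (\<lambda>V. \<Union>((\<lambda>W. X closure_of W) ` {W \<in> \<W>. X closure_of W \<subseteq> V}))"
  have clo: "closedin X (C V)" for V
    unfolding C_def
    by (rule closedin_Union_locally_finite_closure) (rule locally_finite_in_subset[OF \<W>(4)], auto)
  have "\<exists>g. continuous_map X (top_of_set {0..1::real}) g \<and> g ` (topspace X - V) \<subseteq> {0} \<and> g ` C V \<subseteq> {1}"
    if V: "V \<in> \<V>" for V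
  proof -
    have "disjnt (topspace X - V) (C V)"
      by (auto simp: C_def disjnt_def)
    then show ?thesis
      using Urysohn_lemma[OF paracompact_Hausdorff_imp_normal_space[OF X H], of "topspace X - V" "C V" 0 1]
        clo \<V>(1)[OF V] by (metis closedin_diff closedin_topspace zero_le_one)
  qed
  then obtain f where f: "\<And>V. V \<in> \<V> \<Longrightarrow> continuous_map X (top_of_set {0..1::real}) (f V)"
      "\<And>V. V \<in> \<V> \<Longrightarrow> f V ` (topspace X - V) \<subseteq> {0}" "\<And>V. V \<in> \<V> \<Longrightarrow> f V ` C V \<subseteq> {1}"
    by metis
  show thesis
  proof
    show "\<exists>V\<in>\<V>. f V x = 1" if x: "x \<in> topspace X" for x
    proof -
      obtain W where W: "W \<in> \<W>" "x \<in> W"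
        using \<W>(2) x by blast
      then obtain V where V: "V \<in> \<V>" "X closure_of W \<subseteq> V"
        using \<W>(3)[OF W(1)] closure_of_mono unfolding \<O>_def by fastforce
      have "x \<in> C V"
        using W V closure_of_subset[OF openin_subset[OF \<W>(1)[OF W(1)]]] by (auto simp: C_def)
      then show ?thesis
        using f(3) V by blast
    qed
    show "\<And>V x. V \<in> \<V> \<Longrightarrow> x \<in> topspace X \<Longrightarrow> 0 \<le> f V x"
      using f(1) by (fastforce simp: continuous_map_in_subtopology)
    show "\<And>V x. V \<in> \<V> \<Longrightarrow> x \<in> topspace X - V \<Longrightarrow> f V x = 0"
      using f(2) by blast
    show "\<And>V. V \<in> \<V> \<Longrightarrow> continuous_map X euclideanreal (f V)"
      using f(1) by (auto simp: continuous_map_in_subtopology)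
  qed (use \<V> in auto)
qed

text \<open>Well-order the locally finite cover \<open>\<V>\<close>. A point \<open>x\<close> belongs to the first \<open>V\<close> with
  \<open>f V x > 0\<close>, and lies in \<open>A n V\<close> once \<open>1 / (n + 1)\<close> is below this value. Relaxing both conditions
  by half of \<open>1 / (n + 1)\<close> gives open sets \<open>G n V\<close>, which are still disjoint for fixed \<open>n\<close>: the
  value of \<open>f\<close> at the earlier of two indices would have to be above and below that half.
  Local finiteness makes \<open>G n V\<close> open and the union of the \<open>A n V\<close> closed.\<close>
proposition paracompact_sigma_disjoint_refinement:
  assumes X: "paracompact_space X" and H: "Hausdorff_space X"
    and \<U>: "\<forall>U\<in>\<U>. openin X U" "\<Union>\<U> = topspace X"
  obtains A :: "nat \<Rightarrow> 'a set" and \<G> :: "nat \<Rightarrow> 'a set set"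
  where "\<And>n. closedin X (A n)" "topspace X = (\<Union>n. A n)"
    "\<And>n G. G \<in> \<G> n \<Longrightarrow> openin X G" "\<And>n G. G \<in> \<G> n \<Longrightarrow> \<exists>U\<in>\<U>. G \<subseteq> U"
    "\<And>n. pairwise disjnt (\<G> n)" "\<And>n. A n \<subseteq> \<Union>(\<G> n)"
proof (rule paracompact_locally_finite_functions[OF X H \<U>])
  fix \<V> and f :: "'a set \<Rightarrow> 'a \<Rightarrow> real"
  assume \<V>: "\<And>V. V \<in> \<V> \<Longrightarrow> openin X V" "\<And>V. V \<in> \<V> \<Longrightarrow> \<exists>U\<in>\<U>. V \<subseteq> U" "locally_finite_in X \<V>"
    and f: "\<And>V. V \<in> \<V> \<Longrightarrow> continuous_map X euclideanreal (f V)"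
      "\<And>V x. V \<in> \<V> \<Longrightarrow> x \<in> topspace X - V \<Longrightarrow> f V x = 0"
      "\<And>V x. V \<in> \<V> \<Longrightarrow> x \<in> topspace X \<Longrightarrow> 0 \<le> f V x"
      "\<And>x. x \<in> topspace X \<Longrightarrow> \<exists>V\<in>\<V>. f V x = 1"
  obtain r :: "('a set \<times> 'a set) set" where r: "well_order_on UNIV r"
    using well_order_on by blast
  then have wf: "wf (r - Id)" and tot: "\<And>V V'. V \<noteq> V' \<Longrightarrow> (V, V') \<in> r - Id \<or> (V', V) \<in> r - Id"
    by (auto simp: well_order_on_def linear_order_on_def total_on_def)
  define prec where "prec V = {V' \<in> \<V>. (V', V) \<in> r - Id}" for V
  define \<delta> where "\<delta> n = inverse (real (Suc n))" for n
  have \<delta>: "0 < \<delta> n" for n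
    by (simp add: \<delta>_def)
  define A where "A n V = {x \<in> topspace X. \<delta> n \<le> f V x \<and> (\<forall>V'\<in>prec V. f V' x = 0)}" for n V
  define G where "G n V = {x \<in> topspace X. \<delta> n / 2 < f V x \<and> (\<forall>V'\<in>prec V. f V' x < \<delta> n / 2)}" for n V
  have AV: "A n V \<subseteq> V" if "V \<in> \<V>" for n V
    using f(2)[OF that] \<delta>[of n] by (force simp: A_def)
  have GV: "G n V \<subseteq> V" if "V \<in> \<V>" for n V
    using f(2)[OF that] \<delta>[of n] by (force simp: G_def)
  have clA: "closedin X (A n V)" if V: "V \<in> \<V>" for n V
  proof -
    have "closedin X {x \<in> topspace X. f V x \<in> {\<delta> n..}}"
      by (rule closedin_continuous_map_preimage[OF f(1)[OF V]]) auto
    moreover have "closedin X {x \<in> topspace X. f V' x \<in> {0}}" if "V' \<in> prec V" for V'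
      by (rule closedin_continuous_map_preimage[OF f(1)]) (use that in \<open>auto simp: prec_def\<close>)
    moreover have "A n V = \<Inter>(insert {x \<in> topspace X. f V x \<in> {\<delta> n..}}
                      ((\<lambda>V'. {x \<in> topspace X. f V' x \<in> {0}}) ` prec V))"
      by (auto simp: A_def)
    ultimately show ?thesis
      by (simp only:, intro closedin_Inter) auto
  qed
  have opG: "openin X (G n V)" if V: "V \<in> \<V>" for n V
  proof -
    let ?Q = "\<lambda>V'. {x \<in> topspace X. f V' x \<in> {\<delta> n / 2..}}"
    have "locally_finite_in X (?Q ` prec V)"
    proof (rule locally_finite_in_refinement)
      show "locally_finite_in X (prec V)"
        by (rule locally_finite_in_subset[OF \<V>(3)]) (auto simp: prec_def)
      show "?Q V' \<subseteq> V'" if "V' \<in> prec V" for V'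
        using f(2)[of V'] that \<delta>[of n] by (force simp: prec_def)
    qed
    moreover have "closedin X (?Q V')" if "V' \<in> prec V" for V'
      by (rule closedin_continuous_map_preimage[OF f(1)]) (use that in \<open>auto simp: prec_def\<close>)
    ultimately have "closedin X (\<Union>(?Q ` prec V))"
      by (intro closedin_locally_finite_Union) auto
    moreover have "openin X {x \<in> topspace X. f V x \<in> {\<delta> n / 2<..}}"
      by (rule openin_continuous_map_preimage[OF f(1)[OF V]]) auto
    moreover have "G n V = {x \<in> topspace X. f V x \<in> {\<delta> n / 2<..}} - \<Union>(?Q ` prec V)"
      by (auto simp: G_def)
    ultimately show ?thesis
      by (simp only: openin_diff)
  qed
  show thesis
  proof
    show "closedin X (\<Union>(A n ` \<V>))" for n
      using clA AV by (intro closedin_locally_finite_Union locally_finite_in_refinement[OF \<V>(3)]) auto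
    show "topspace X = (\<Union>n. \<Union>(A n ` \<V>))"
    proof (intro equalityI subsetI)
      fix x
      assume x: "x \<in> topspace X"
      define P where "P = {V \<in> \<V>. 0 < f V x}"
      have "P \<noteq> {}"
        using f(4)[OF x] by (force simp: P_def)
      then obtain V where V: "V \<in> P" "\<And>V'. (V', V) \<in> r - Id \<Longrightarrow> V' \<notin> P"
        using wfE_min'[OF wf, of P] by blast
      then obtain n where "\<delta> n < f V x"
        using reals_Archimedean[of "f V x"] by (auto simp: P_def \<delta>_def)
      moreover have "f V' x = 0" if "V' \<in> prec V" for V'
        using V(2)[of V'] that f(3)[of V' x] x by (auto simp: P_def prec_def)
      ultimately show "x \<in> (\<Union>n. \<Union>(A n ` \<V>))"
        using V x by (auto simp: A_def P_def intro!: exI[of _ n] bexI[of _ V])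
    qed (auto simp: A_def)
    show "openin X H" if "H \<in> G n ` \<V>" for n H
      using that opG by auto
    show "\<exists>U\<in>\<U>. H \<subseteq> U" if "H \<in> G n ` \<V>" for n H
    proof -
      from that obtain V where "V \<in> \<V>" "H = G n V"
        by blast
      then show ?thesis
        using GV[of V n] \<V>(2)[of V] by blast
    qed
    have "disjnt (G n V) (G n V')" if "V \<in> \<V>" "V' \<in> \<V>" "V \<noteq> V'" for n V V'
      using tot[OF that(3)] that(1,2) by (force simp: G_def prec_def disjnt_def)
    then show "pairwise disjnt (G n ` \<V>)" for n
      by (auto simp: pairwise_def)
    show "\<Union>(A n ` \<V>) \<subseteq> \<Union>(G n ` \<V>)" for n
    proof -
      have "A n V \<subseteq> G n V" for V
        using \<delta>[of n] by (auto simp: A_def G_def)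
      then show ?thesis
        by blast
    qed
  qed
qed

section \<open>The space with an outer collar attached\<close>

text \<open>The points \<open>(x, 0)\<close> form a copy of \<open>X\<close>. When \<open>B\<close> is closed, this copy and \<open>B \<times> (-\<infinity>, 0]\<close>
  are both closed in \<open>X \<times> \<real>\<close>, so that the subspace is the result of gluing them along \<open>B\<close>.\<close>
definition outer_collar :: "'a topology \<Rightarrow> 'a set \<Rightarrow> ('a \<times> real) topology" where
  "outer_collar X B =
     subtopology (prod_topology X euclideanreal) {p. snd p = 0 \<or> fst p \<in> B \<and> snd p \<le> 0}"

lemma topspace_outer_collar:
  "topspace (outer_collar X B) = {p. fst p \<in> topspace X \<and> (snd p = 0 \<or> fst p \<in> B \<and> snd p \<le> 0)}"
  by (auto simp: outer_collar_def)

lemma continuous_map_into_outer_collar: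
  "continuous_map Y (outer_collar X B) f \<longleftrightarrow>
     continuous_map Y X (\<lambda>y. fst (f y)) \<and> continuous_map Y euclideanreal (\<lambda>y. snd (f y)) \<and>
     (\<forall>y\<in>topspace Y. snd (f y) = 0 \<or> fst (f y) \<in> B \<and> snd (f y) \<le> 0)"
  by (auto simp: outer_collar_def continuous_map_in_subtopology continuous_map_pairwise o_def)

lemma continuous_map_fst_outer_collar: "continuous_map (outer_collar X B) X fst"
  unfolding outer_collar_def by (intro continuous_map_from_subtopology continuous_map_fst)

lemma continuous_map_snd_outer_collar: "continuous_map (outer_collar X B) euclideanreal snd"
  unfolding outer_collar_def by (intro continuous_map_from_subtopology continuous_map_snd)

lemma openin_outer_collar_Times_UNIV:
  assumes "openin X V"
  shows "openin (outer_collar X B) (topspace (outer_collar X B) \<inter> V \<times> UNIV)"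
proof -
  have "topspace (outer_collar X B) \<inter> V \<times> UNIV = {p \<in> topspace (outer_collar X B). fst p \<in> V}"
    by auto
  then show ?thesis
    using openin_continuous_map_preimage[OF continuous_map_fst_outer_collar assms] by simp
qed

section \<open>Pushing along a local collar\<close>

text \<open>Projecting away \<open>K\<close> is an open map, and a closed one because \<open>K\<close> is compact. The sublevel sets
  of the minimum are projections of sublevel sets of \<open>F\<close>.\<close>
lemma continuous_map_Inf_compact:
  fixes F :: "'a \<times> 'b \<Rightarrow> real"
  assumes F: "continuous_map (prod_topology Y K) euclideanreal F"
    and K: "compact_space K" "topspace K \<noteq> {}"
  obtains m where "continuous_map Y euclideanreal m"
    "\<And>y s. y \<in> topspace Y \<Longrightarrow> s \<in> topspace K \<Longrightarrow> m y \<le> F (y, s)"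
    "\<And>y. y \<in> topspace Y \<Longrightarrow> \<exists>s\<in>topspace K. m y = F (y, s)"
proof -
  have "\<exists>s\<in>topspace K. \<forall>s'\<in>topspace K. F (y, s) \<le> F (y, s')" if y: "y \<in> topspace Y" for y
  proof -
    have "continuous_map K (prod_topology Y K) (\<lambda>s. (y, s))"
      using y by (auto simp: continuous_map_paired)
    then have "continuous_map K euclideanreal (\<lambda>s. F (y, s))"
      using continuous_map_compose[OF _ F] by (simp add: o_def)
    then have "compact ((\<lambda>s. F (y, s)) ` topspace K)"
      using K image_compactin compact_space_def by (metis compactin_euclidean_iff)
    then show ?thesis
      using compact_attains_inf[of "(\<lambda>s. F (y, s)) ` topspace K"] K by auto
  qed
  then obtain \<sigma> where \<sigma>: "\<And>y. y \<in> topspace Y \<Longrightarrow> \<sigma> y \<in> topspace K"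
    "\<And>y s. y \<in> topspace Y \<Longrightarrow> s \<in> topspace K \<Longrightarrow> F (y, \<sigma> y) \<le> F (y, s)"
    by metis
  define m where "m y = F (y, \<sigma> y)" for y
  show thesis
  proof
    have "openin Y {y \<in> topspace Y. m y < a}" for a
    proof -
      have "openin (prod_topology Y K) {p \<in> topspace (prod_topology Y K). F p \<in> {..<a}}"
        by (rule openin_continuous_map_preimage[OF F]) auto
      then have "openin Y (fst ` {p \<in> topspace (prod_topology Y K). F p \<in> {..<a}})"
        using open_map_fst unfolding open_map_def by blast
      also have "fst ` {p \<in> topspace (prod_topology Y K). F p \<in> {..<a}} = {y \<in> topspace Y. m y < a}"
        using \<sigma> unfolding m_def by (force simp: image_iff)
      finally show ?thesis .
    qed
    moreover have "closedin Y {y \<in> topspace Y. m y \<le> a}" for a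
    proof -
      have "closedin (prod_topology Y K) {p \<in> topspace (prod_topology Y K). F p \<in> {..a}}"
        by (rule closedin_continuous_map_preimage[OF F]) auto
      then have "closedin Y (fst ` {p \<in> topspace (prod_topology Y K). F p \<in> {..a}})"
        using closed_map_fst[OF K(1)] unfolding closed_map_def by blast
      also have "fst ` {p \<in> topspace (prod_topology Y K). F p \<in> {..a}} = {y \<in> topspace Y. m y \<le> a}"
        using \<sigma> unfolding m_def by (force simp: image_iff)
      finally show ?thesis .
    qed
    ultimately show "continuous_map Y euclideanreal m"
      using continuous_map_upper_lower_semicontinuous_lte_gen[of Y UNIV m] by simp
  qed (use \<sigma> in \<open>auto simp: m_def\<close>)
qed

text \<open>For \<open>e \<ge> 0\<close>, the increasing piecewise linear bijection of the line that translates \<open>(-\<infinity>, 0]\<close> by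
  \<open>e / 2\<close>, compresses \<open>[0, e]\<close> to \<open>[e / 2, e]\<close>, and fixes everything from \<open>e\<close> on. The lattice
  form makes continuity in both arguments immediate.\<close>
definition stretch :: "real \<Rightarrow> real \<Rightarrow> real" where
  "stretch e t = max t (min (t + e / 2) ((t + e) / 2))"

definition unstretch :: "real \<Rightarrow> real \<Rightarrow> real" where
  "unstretch e t = min t (max (t - e / 2) (2 * t - e))"

lemma unstretch_stretch: "0 \<le> e \<Longrightarrow> unstretch e (stretch e t) = t"
  by (auto simp: stretch_def unstretch_def max_def min_def field_simps)

lemma stretch_unstretch: "0 \<le> e \<Longrightarrow> stretch e (unstretch e t) = t"
  by (auto simp: stretch_def unstretch_def max_def min_def)

lemma stretch_eq_add: "0 \<le> e \<Longrightarrow> t \<le> 0 \<Longrightarrow> stretch e t = t + e / 2"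
  by (auto simp: stretch_def max_def min_def)

lemma stretch_eq_self: "0 \<le> e \<Longrightarrow> e \<le> t \<Longrightarrow> stretch e t = t"
  by (auto simp: stretch_def max_def min_def)

lemma stretch_less_1: "e \<le> 1 \<Longrightarrow> t < 1 \<Longrightarrow> stretch e t < 1"
  by (auto simp: stretch_def max_def min_def)

lemma unstretch_less_1: "t < 1 \<Longrightarrow> unstretch e t < 1"
  by (auto simp: unstretch_def)

lemma homeomorphic_maps_stretch:
  assumes e: "continuous_map Y euclideanreal e" "\<And>y. y \<in> topspace Y \<Longrightarrow> 0 \<le> e y \<and> e y \<le> 1"
  shows "homeomorphic_maps (prod_topology Y (top_of_set {..<1})) (prod_topology Y (top_of_set {..<1}))
           (\<lambda>p. (fst p, stretch (e (fst p)) (snd p))) (\<lambda>p. (fst p, unstretch (e (fst p)) (snd p)))"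
proof -
  let ?P = "prod_topology Y (top_of_set {..<1::real})"
  have e': "continuous_map ?P euclideanreal (\<lambda>p. e (fst p))"
    using continuous_map_compose[OF continuous_map_fst e(1)] by (simp add: o_def)
  have f: "continuous_map ?P Y fst"
    by (rule continuous_map_fst)
  have s: "continuous_map ?P euclideanreal snd"
    using continuous_map_snd continuous_map_into_fulltopology by blast
  have half: "continuous_map ?P euclideanreal (\<lambda>p. h p / 2)"
    if "continuous_map ?P euclideanreal h" for h
    using continuous_map_real_mult_right[OF that, of "1/2"] by simp
  have "continuous_map ?P euclideanreal (\<lambda>p. stretch (e (fst p)) (snd p))"
    unfolding stretch_def
    by (intro continuous_map_real_max continuous_map_real_min continuous_map_add half s e')
  moreover have "continuous_map ?P euclideanreal (\<lambda>p. unstretch (e (fst p)) (snd p))"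
    unfolding unstretch_def
    by (intro continuous_map_real_max continuous_map_real_min continuous_map_diff half
        continuous_map_real_mult_left s e')
  ultimately show ?thesis
    using e(2) f unfolding homeomorphic_maps_def
    by (auto simp: continuous_map_paired continuous_map_in_subtopology unstretch_stretch
        stretch_unstretch stretch_less_1 unstretch_less_1)
qed

lemma local_collar_image_Int:
  assumes "local_collar X B U c"
  shows "c ` (U \<times> {0..<1}) \<inter> B = U"
proof -
  have UB: "U \<subseteq> B" "U \<subseteq> X closure_of U"
    using assms openin_subset closure_of_subset by (fastforce simp: local_collar_def)+
  have c0: "c (b, 0) = b" if "b \<in> U" for b
    using assms that UB by (auto simp: local_collar_def)
  have cB: "t = 0" if "b \<in> U" "0 \<le> t" "t < 1" "c (b, t) \<in> B" for b t
  proof -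
    have "b \<in> X closure_of U" "t \<in> {0..1}"
      using that UB by auto
    then show ?thesis
      using assms that(4) unfolding local_collar_def by blast
  qed
  show ?thesis
  proof
    show "c ` (U \<times> {0..<1}) \<inter> B \<subseteq> U"
      using cB c0 by force
    show "U \<subseteq> c ` (U \<times> {0..<1}) \<inter> B"
      using c0 UB by (force simp: image_iff)
  qed
qed

text \<open>A local collar continued by the outer collar. Both the chart and its inverse are pasted from two
  closed pieces, which meet in the copy of \<open>U\<close> at height \<open>0\<close>; over \<open>V\<close> the outer collar adds no
  point outside \<open>U \<times> (-\<infinity>, 0]\<close> because \<open>V \<inter> B = U\<close>.\<close>
lemma local_collar_chart:
  assumes B: "closedin X B" and c: "local_collar X B U c"
  defines "V \<equiv> c ` (U \<times> {0..<1})"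
  obtains \<kappa> \<kappa>' where
    "homeomorphic_maps (prod_topology (subtopology X U) (top_of_set {..<1}))
       (subtopology (outer_collar X B) (V \<times> UNIV)) \<kappa> \<kappa>'"
    "\<And>b t. t \<le> 0 \<Longrightarrow> \<kappa> (b, t) = (b, t)"
    "\<And>b t. b \<in> U \<Longrightarrow> 0 \<le> t \<Longrightarrow> \<kappa> (b, t) = (c (b, t), 0)"
proof -
  let ?Z = "outer_collar X B" and ?cl = "X closure_of U"
  let ?Y = "prod_topology (subtopology X U) (top_of_set {..<1::real})"
  let ?C = "prod_topology (subtopology X ?cl) (top_of_set {0..1::real})"
  have UB: "U \<subseteq> B" "U \<subseteq> topspace X"
    using c openin_subset by (fastforce simp: local_collar_def)+
  have Ucl: "U \<subseteq> ?cl"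
    using closure_of_subset[OF UB(2)] .
  have clX: "?cl \<subseteq> topspace X"
    by (rule closure_of_subset_topspace)
  have c0: "c (b, 0) = b" if "b \<in> ?cl" for b
    using c that by (simp add: local_collar_def)
  have cB: "t = 0" if "b \<in> ?cl" "t \<in> {0..1}" "c (b, t) \<in> B" for b t
    using c that unfolding local_collar_def by blast
  obtain d where "homeomorphic_maps ?C (subtopology X (c ` topspace ?C)) c d"
    using c unfolding local_collar_def embedding_map_def homeomorphic_map_maps by blast
  moreover have topC: "topspace ?C = ?cl \<times> {0..1}"
    using clX by auto
  ultimately have cc: "continuous_map ?C X c"
    and cd: "continuous_map (subtopology X (c ` (?cl \<times> {0..1}))) ?C d"
    and dc: "\<And>q. q \<in> ?cl \<times> {0..1} \<Longrightarrow> d (c q) = q"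
    by (auto simp: homeomorphic_maps_def continuous_map_in_subtopology)
  have topY: "topspace ?Y = U \<times> {..<1}"
    using UB by auto
  have cX: "c q \<in> topspace X" if "q \<in> ?cl \<times> {0..1}" for q
    using cc that unfolding continuous_map_def topC by blast
  have VX: "V \<subseteq> topspace X"
    using cX Ucl by (fastforce simp: V_def)
  have VB: "x \<in> U" "d x = (x, 0)" if x: "x \<in> V" "x \<in> B" for x
  proof -
    show U: "x \<in> U"
      using local_collar_image_Int[OF c] x unfolding V_def by blast
    show "d x = (x, 0)"
      using dc[of "(x, 0)"] c0[of x] Ucl U by auto
  qed
  define \<kappa> where "\<kappa> p = (if snd p \<le> 0 then p else (c p, 0))" for p
  define \<kappa>' where "\<kappa>' q = (if fst q \<in> B then q else d (fst q))" for q :: "'a \<times> real"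
  have cont_\<kappa>: "continuous_map ?Y ?Z \<kappa>"
    unfolding \<kappa>_def
  proof (rule continuous_map_cases_le)
    show "continuous_map ?Y euclideanreal snd"
      using continuous_map_snd continuous_map_into_fulltopology by blast
    let ?N = "{x \<in> topspace ?Y. snd x \<le> 0}"
    have "continuous_map ?Y X fst"
      using continuous_map_fst continuous_map_into_fulltopology by blast
    moreover have "continuous_map ?Y euclideanreal snd"
      using continuous_map_snd continuous_map_into_fulltopology by blast
    ultimately show "continuous_map (subtopology ?Y ?N) ?Z (\<lambda>p. p)"
      using UB by (auto simp: continuous_map_into_outer_collar continuous_map_from_subtopology)
    let ?P = "{x \<in> topspace ?Y. 0 \<le> snd x}"
    have "subtopology ?Y ?P = subtopology (prod_topology X euclideanreal) (U \<times> {0..<1})"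
      unfolding subtopology_Times[symmetric] subtopology_subtopology topY
      by (rule arg_cong[of _ _ "subtopology _"]) (use UB in auto)
    also have "\<dots> = subtopology ?C (U \<times> {0..<1})"
      unfolding subtopology_Times[symmetric] subtopology_subtopology
      by (rule arg_cong[of _ _ "subtopology _"]) (use Ucl in auto)
    finally show "continuous_map (subtopology ?Y ?P) ?Z (\<lambda>p. (c p, 0))"
      using continuous_map_from_subtopology[OF cc] by (simp add: continuous_map_into_outer_collar)
    show "x = (c x, 0)" if "x \<in> topspace ?Y" "snd x = 0" for x
      using that c0 Ucl unfolding topY by (cases x) auto
  qed auto
  have "continuous_map (subtopology ?Z (V \<times> UNIV)) (prod_topology X euclideanreal) \<kappa>'"
  proof (rule pasting_lemma_closed[where I = "UNIV :: bool set"
        and T = "\<lambda>i. if i then {p \<in> topspace (subtopology ?Z (V \<times> UNIV)). fst p \<in> B}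
                          else {p \<in> topspace (subtopology ?Z (V \<times> UNIV)). snd p \<in> {0}}"
        and f = "\<lambda>i q. if i then q else d (fst q)"])
    let ?W = "subtopology ?Z (V \<times> UNIV)"
    have 1: "continuous_map ?W X fst" "continuous_map ?W euclideanreal snd"
      by (intro continuous_map_from_subtopology continuous_map_fst_outer_collar
          continuous_map_snd_outer_collar)+
    have "closedin ?W {p \<in> topspace ?W. fst p \<in> B}" "closedin ?W {p \<in> topspace ?W. snd p \<in> {0}}"
      using closedin_continuous_map_preimage[OF 1(1) B] closedin_continuous_map_preimage[OF 1(2), of "{0}"]
      by (simp_all only: closed_closedin[symmetric] closed_singleton simp_thms True_implies_equals)
    then show "closedin ?W (if i then {p \<in> topspace ?W. fst p \<in> B} else {p \<in> topspace ?W. snd p \<in> {0}})" for i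
      by simp
    have "continuous_map ?W (prod_topology X euclideanreal) (\<lambda>q. q)"
      using 1 by (simp add: continuous_map_pairwise o_def)
    moreover have "continuous_map ?W (prod_topology X euclideanreal) (\<lambda>q. d (fst q))"
    proof -
      have "continuous_map ?W (subtopology X (c ` (?cl \<times> {0..1}))) fst"
        unfolding continuous_map_in_subtopology using 1(1) Ucl by (fastforce simp: V_def)
      from continuous_map_compose[OF this cd] have "continuous_map ?W ?C (\<lambda>q. d (fst q))"
        by (simp add: o_def)
      then show ?thesis
        unfolding subtopology_Times[symmetric] by (rule continuous_map_into_fulltopology)
    qed
    ultimately show "continuous_map (subtopology ?W (if i then {p \<in> topspace ?W. fst p \<in> B}
                          else {p \<in> topspace ?W. snd p \<in> {0}}))
             (prod_topology X euclideanreal) (\<lambda>q. if i then q else d (fst q))" for i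
      by (cases i) (simp_all add: continuous_map_from_subtopology)
  qed (use VB in \<open>auto simp: \<kappa>'_def topspace_outer_collar split: if_splits\<close>)
  moreover have \<kappa>'im: "\<kappa>' q \<in> U \<times> {..<1}" if "q \<in> topspace (subtopology ?Z (V \<times> UNIV))" for q
  proof (cases "fst q \<in> B")
    case True
    then show ?thesis
      using that VB(1)[of "fst q"] by (cases q) (auto simp: \<kappa>'_def topspace_outer_collar)
  next
    case False
    have "fst q \<in> V"
      using that by auto
    then obtain p where "p \<in> U \<times> {0..<1}" "fst q = c p"
      unfolding V_def by blast
    then show ?thesis
      using False dc[of p] Ucl by (auto simp: \<kappa>'_def)
  qed
  ultimately have cont_\<kappa>': "continuous_map (subtopology ?Z (V \<times> UNIV)) ?Y \<kappa>'"
    unfolding subtopology_Times[symmetric] by (intro continuous_map_into_subtopology) auto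
  show thesis
  proof
    show "homeomorphic_maps ?Y (subtopology ?Z (V \<times> UNIV)) \<kappa> \<kappa>'"
      unfolding homeomorphic_maps_def
    proof (intro conjI ballI)
      have "\<kappa> p \<in> V \<times> UNIV" if "p \<in> topspace ?Y" for p
      proof (cases "snd p \<le> 0")
        case True
        then have "fst p = c (fst p, 0)" "fst p \<in> U"
          using that c0 Ucl topY by auto
        then have "fst p \<in> V"
          unfolding V_def by (metis SigmaI atLeastLessThan_iff image_eqI less_numeral_extra(1) order_refl)
        then show ?thesis
          using True by (cases p) (auto simp: \<kappa>_def)
      next
        case False
        then show ?thesis
          using that unfolding topY by (cases p) (auto simp: \<kappa>_def V_def)
      qed
      then show "continuous_map ?Y (subtopology ?Z (V \<times> UNIV)) \<kappa>"
        using cont_\<kappa> by (intro continuous_map_into_subtopology) auto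
      show "continuous_map (subtopology ?Z (V \<times> UNIV)) ?Y \<kappa>'"
        by (rule cont_\<kappa>')
      show "\<kappa>' (\<kappa> p) = p" if "p \<in> topspace ?Y" for p
        using that UB Ucl dc[of p] cB[of "fst p" "snd p"] unfolding topY
        by (cases p) (auto simp: \<kappa>_def \<kappa>'_def)
      show "\<kappa> (\<kappa>' q) = q" if q: "q \<in> topspace (subtopology ?Z (V \<times> UNIV))" for q
      proof (cases "fst q \<in> B")
        case True
        then show ?thesis
          using q by (cases q) (auto simp: \<kappa>_def \<kappa>'_def topspace_outer_collar)
      next
        case False
        then obtain p where p: "p \<in> U \<times> {0..<1}" "fst q = c p" "snd q = 0"
        proof -
          have "fst q \<in> V" "snd q = 0"
            using q False by (auto simp: topspace_outer_collar)
          then show ?thesis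
            using that unfolding V_def by blast
        qed
        moreover have "snd p \<noteq> 0"
        proof
          assume "snd p = 0"
          then have "c p = fst p" "fst p \<in> U"
            using p c0[of "fst p"] Ucl by (cases p; auto)+
          then show False
            using p False UB by auto
        qed
        ultimately show ?thesis
          using False dc[of p] Ucl by (cases q) (auto simp: \<kappa>_def \<kappa>'_def)
      qed
    qed
    show "\<kappa> (b, t) = (b, t)" if "t \<le> 0" for b t
      using that by (simp add: \<kappa>_def)
    show "\<kappa> (b, t) = (c (b, t), 0)" if "b \<in> U" "0 \<le> t" for b t
      using that c0 Ucl by (auto simp: \<kappa>_def)
  qed
qed

text \<open>Stretch the fibre of \<open>b\<close> by \<open>e b = (INF s\<in>{0..1}. s + \<psi> (c (b, s)))\<close>. This moves points
  below \<open>e b\<close> only, and none if \<open>e b = 0\<close>. If \<open>0 \<le> s < e b\<close>, then \<open>\<psi> (c (b, s)) > 0\<close>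
  since otherwise \<open>s\<close> itself would bound the infimum; so only points over the support of \<open>\<psi>\<close> move. The infimum is attained, hence positive when \<open>\<psi> b > 0\<close>.\<close>
lemma local_collar_push:
  assumes B: "closedin X B" and c: "local_collar X B U c"
    and \<psi>: "continuous_map X euclideanreal \<psi>" "\<And>x. x \<in> topspace X \<Longrightarrow> 0 \<le> \<psi> x \<and> \<psi> x \<le> 1"
  defines "W \<equiv> subtopology (outer_collar X B) (c ` (U \<times> {0..<1}) \<times> UNIV)"
  obtains g g' h where
    "homeomorphic_maps W W g g'"
    "\<And>p. p \<in> topspace W \<Longrightarrow> g p \<noteq> p \<Longrightarrow> 0 < \<psi> (fst p)"
    "\<And>b. b \<in> U \<Longrightarrow> 0 \<le> h b \<and> h b \<le> \<psi> b \<and> (0 < \<psi> b \<longrightarrow> 0 < h b)"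
    "\<And>b s. b \<in> U \<Longrightarrow> s \<le> - h b \<Longrightarrow> g (b, s) = (b, s + h b)"
proof -
  let ?K = "top_of_set {0..1::real}"
  let ?Y = "prod_topology (subtopology X U) (top_of_set {..<1::real})"
  have UX: "U \<subseteq> topspace X"
    using c openin_subset by (fastforce simp: local_collar_def)
  have Ucl: "U \<subseteq> X closure_of U"
    using closure_of_subset[OF UX] .
  have c0: "c (b, 0) = b" if "b \<in> U" for b
    using c that Ucl by (auto simp: local_collar_def)
  have "continuous_map (prod_topology (subtopology X (X closure_of U)) ?K) X c"
    using c homeomorphic_imp_continuous_map continuous_map_into_fulltopology
    unfolding local_collar_def embedding_map_def by blast
  then have cc: "continuous_map (prod_topology (subtopology X U) ?K) X c"
    unfolding subtopology_Times[symmetric]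
    by (rule continuous_map_from_subtopology_mono) (use Ucl in auto)
  have cX: "c (b, s) \<in> topspace X" if "b \<in> U" "s \<in> {0..1}" for b s
    using continuous_map_image_subset_topspace[OF cc] that UX by (auto simp: image_subset_iff)
  let ?F = "\<lambda>p. snd p + \<psi> (c p)"
  have "continuous_map (prod_topology (subtopology X U) ?K) euclideanreal ?F"
  proof (rule continuous_map_add)
    show "continuous_map (prod_topology (subtopology X U) ?K) euclideanreal snd"
      using continuous_map_snd continuous_map_into_fulltopology by blast
    show "continuous_map (prod_topology (subtopology X U) ?K) euclideanreal (\<lambda>p. \<psi> (c p))"
      using continuous_map_compose[OF cc \<psi>(1)] by (simp add: o_def)
  qed
  moreover have "compact_space ?K" "topspace ?K \<noteq> {}"
    by (auto simp: compact_space_subtopology)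
  ultimately obtain e where e: "continuous_map (subtopology X U) euclideanreal e"
      "\<And>y s. y \<in> topspace (subtopology X U) \<Longrightarrow> s \<in> topspace ?K \<Longrightarrow> e y \<le> ?F (y, s)"
      "\<And>y. y \<in> topspace (subtopology X U) \<Longrightarrow> \<exists>s\<in>topspace ?K. e y = ?F (y, s)"
    by (rule continuous_map_Inf_compact) (rule that)
  have e_le: "e b \<le> s + \<psi> (c (b, s))" if "b \<in> U" "s \<in> {0..1}" for b s
    using e(2)[of b s] that UX by auto
  have e_eq: "\<exists>s\<in>{0..1}. e b = s + \<psi> (c (b, s))" if "b \<in> U" for b
    using e(3)[of b] that UX by auto
  have e_nonneg: "0 \<le> e b" if b: "b \<in> U" for b
  proof -
    obtain s where s: "s \<in> {0..1}" "e b = s + \<psi> (c (b, s))"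
      using e_eq[OF b] by blast
    then show ?thesis
      using \<psi>(2)[OF cX[OF b s(1)]] by auto
  qed
  have e_le_\<psi>: "e b \<le> \<psi> b" if "b \<in> U" for b
    using e_le[OF that, of 0] c0[OF that] by simp
  have e_pos: "0 < e b" if b: "b \<in> U" and "0 < \<psi> b" for b
  proof -
    obtain s where s: "s \<in> {0..1}" "e b = s + \<psi> (c (b, s))"
      using e_eq[OF b] by blast
    then show ?thesis
      using \<psi>(2)[OF cX[OF b s(1)]] c0[OF b] that(2) by (cases "s = 0") auto
  qed
  have e_le_1: "e b \<le> 1" if "b \<in> U" for b
    using e_le_\<psi>[OF that] \<psi>(2)[of b] that UX by auto
  have pos: "0 < \<psi> (c (b, s))" if "b \<in> U" "0 \<le> s" "s < e b" for b s
    using e_le[OF that(1), of s] e_le_1[OF that(1)] that by auto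
  obtain \<kappa> \<kappa>' where \<kappa>: "homeomorphic_maps ?Y W \<kappa> \<kappa>'"
    and \<kappa>_neg: "\<And>b t. t \<le> 0 \<Longrightarrow> \<kappa> (b, t) = (b, t)"
    and \<kappa>_pos: "\<And>b t. b \<in> U \<Longrightarrow> 0 \<le> t \<Longrightarrow> \<kappa> (b, t) = (c (b, t), 0)"
    by (rule local_collar_chart[OF B c, folded W_def]) (rule that)
  have topY: "topspace ?Y = U \<times> {..<1}"
    using UX by auto
  let ?\<theta> = "\<lambda>p. (fst p, stretch (e (fst p)) (snd p))" and ?\<theta>' = "\<lambda>p. (fst p, unstretch (e (fst p)) (snd p))"
  have \<theta>: "homeomorphic_maps ?Y ?Y ?\<theta> ?\<theta>'"
    by (rule homeomorphic_maps_stretch[OF e(1)]) (use e_nonneg e_le_1 in auto)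
  have \<kappa>\<kappa>': "\<kappa>' (\<kappa> (b, t)) = (b, t)" if "b \<in> U" "t < 1" for b t
  proof -
    have "(b, t) \<in> topspace ?Y"
      unfolding topY using that by simp
    then show ?thesis
      using \<kappa> by (simp add: homeomorphic_maps_def)
  qed
  show thesis
  proof
    show "homeomorphic_maps W W (\<kappa> \<circ> (?\<theta> \<circ> \<kappa>')) ((\<kappa> \<circ> ?\<theta>') \<circ> \<kappa>')"
    proof -
      have "homeomorphic_maps W ?Y \<kappa>' \<kappa>"
        by (rule iffD1[OF homeomorphic_maps_sym \<kappa>])
      then have "homeomorphic_maps W ?Y (?\<theta> \<circ> \<kappa>') (\<kappa> \<circ> ?\<theta>')"
        using \<theta> by (rule homeomorphic_maps_compose[OF conjI])
      then show ?thesis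
        using \<kappa> by (rule homeomorphic_maps_compose[OF conjI])
    qed
    show "0 < \<psi> (fst p)" if p: "p \<in> topspace W" "(\<kappa> \<circ> (?\<theta> \<circ> \<kappa>')) p \<noteq> p" for p
    proof -
      obtain b t where bt: "b \<in> U" "t < 1" "p = \<kappa> (b, t)"
      proof -
        have "continuous_map W ?Y \<kappa>'" "\<kappa> (\<kappa>' p) = p"
          using \<kappa> p(1) by (auto simp: homeomorphic_maps_def)
        then have "\<kappa>' p \<in> U \<times> {..<1}"
          using p(1) continuous_map_image_subset_topspace[of W ?Y \<kappa>'] unfolding topY by blast
        then show ?thesis
          using \<open>\<kappa> (\<kappa>' p) = p\<close> that by (cases "\<kappa>' p") auto
      qed
      then have "\<kappa> (b, stretch (e b) t) \<noteq> \<kappa> (b, t)"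
        using p(2) \<kappa>\<kappa>'[OF bt(1,2)] by simp
      then have t: "t < e b"
        using stretch_eq_self[OF e_nonneg[OF bt(1)], of t] by (cases "t < e b") auto
      show ?thesis
      proof (cases "t \<le> 0")
        case True
        then have "0 < e b \<or> e b = 0 \<and> t < 0"
          using e_nonneg[OF bt(1)] t by linarith
        moreover have "e b \<noteq> 0"
          using \<open>\<kappa> (b, stretch (e b) t) \<noteq> \<kappa> (b, t)\<close> stretch_eq_add[of "e b" t] True by auto
        ultimately show ?thesis
          using True bt e_le_\<psi>[OF bt(1)] by (auto simp: \<kappa>_neg)
      next
        case False
        then show ?thesis
          using bt pos[OF bt(1) _ t] by (auto simp: \<kappa>_pos)
      qed
    qed
    show "0 \<le> e b / 2 \<and> e b / 2 \<le> \<psi> b \<and> (0 < \<psi> b \<longrightarrow> 0 < e b / 2)" if "b \<in> U" for b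
      using e_nonneg[OF that] e_le_\<psi>[OF that] e_pos[OF that] by auto
    show "(\<kappa> \<circ> (?\<theta> \<circ> \<kappa>')) (b, s) = (b, s + e b / 2)" if b: "b \<in> U" and s: "s \<le> - (e b / 2)" for b s
    proof -
      have "s \<le> 0"
        using s e_nonneg[OF b] by linarith
      then have "\<kappa>' (b, s) = (b, s)"
        using \<kappa>\<kappa>'[OF b, of s] by (simp add: \<kappa>_neg)
      then show ?thesis
        using s stretch_eq_add[OF e_nonneg[OF b] \<open>s \<le> 0\<close>] by (simp add: \<kappa>_neg)
    qed
  qed
qed

section \<open>Simultaneous pushes along a disjoint family\<close>

text \<open>Over \<open>G \<in> \<G>\<close> use the push for \<open>\<psi>\<close> cut off outside \<open>G\<close>. It moves points over \<open>G\<close> only and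
  keeps them over \<open>G\<close>, so that gluing the pushes and gluing their inverses give inverse maps. Both
  are continuous: they agree with a push over each \<open>G\<close> and with the identity over the complement of
  \<open>F\<close>, and these open sets cover the space.\<close>
lemma disjoint_push:
  assumes B: "closedin X B"
    and \<G>: "\<And>G. G \<in> \<G> \<Longrightarrow> openin X G" "pairwise disjnt \<G>"
      "\<And>G. G \<in> \<G> \<Longrightarrow> \<exists>U c. local_collar X B U c \<and> G \<subseteq> c ` (U \<times> {0..<1})"
    and \<psi>: "continuous_map X euclideanreal \<psi>" "\<And>x. x \<in> topspace X \<Longrightarrow> 0 \<le> \<psi> x \<and> \<psi> x \<le> 1"
    and F: "closedin X F" "F \<subseteq> \<Union>\<G>" "\<And>x. x \<in> topspace X - F \<Longrightarrow> \<psi> x = 0"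
  obtains \<tau> h where
    "homeomorphic_map (outer_collar X B) (outer_collar X B) \<tau>"
    "\<And>b. b \<in> B \<Longrightarrow> 0 \<le> h b \<and> h b \<le> \<psi> b \<and> (0 < \<psi> b \<longrightarrow> 0 < h b)"
    "\<And>b s. b \<in> B \<Longrightarrow> s \<le> - h b \<Longrightarrow> \<tau> (b, s) = (b, s + h b)"
proof -
  let ?Z = "outer_collar X B"
  have same: "G = G'" if "G \<in> \<G>" "G' \<in> \<G>" "x \<in> G" "x \<in> G'" for G G' x
    using \<G>(2) that unfolding pairwise_def disjnt_def by blast
  define \<psi>' where "\<psi>' G x = (if x \<in> G then \<psi> x else 0)" for G x
  have \<psi>'cont: "continuous_map X euclideanreal (\<psi>' G)" if G: "G \<in> \<G>" for G
  proof (rule pasting_lemma[where I = "UNIV :: bool set" and f = "\<lambda>i. if i then \<psi> else (\<lambda>x. 0)"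
        and T = "\<lambda>i. if i then G else (topspace X - F) \<union> \<Union>(\<G> - {G})"])
    show "openin X (if i then G else (topspace X - F) \<union> \<Union>(\<G> - {G}))" for i
      using G \<G>(1) F(1) by (cases i) (auto intro!: openin_Un openin_diff)
    show "continuous_map (subtopology X (if i then G else (topspace X - F) \<union> \<Union>(\<G> - {G})))
            euclideanreal (if i then \<psi> else (\<lambda>x. 0))" for i
      using \<psi>(1) by (auto simp: continuous_map_from_subtopology)
    show "\<exists>j. j \<in> UNIV \<and> x \<in> (if j then G else (topspace X - F) \<union> \<Union>(\<G> - {G})) \<and>
             \<psi>' G x = (if j then \<psi> else (\<lambda>x. 0)) x" if "x \<in> topspace X" for x
    proof (cases "x \<in> G")
      case True
      then show ?thesis
        by (intro exI[of _ True]) (auto simp: \<psi>'_def)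
    next
      case False
      then show ?thesis
        using that F(2) by (intro exI[of _ False]) (auto simp: \<psi>'_def)
    qed
  qed (use G same F(3) in \<open>auto split: if_splits\<close>)
  obtain U c where Uc: "\<And>G. G \<in> \<G> \<Longrightarrow> local_collar X B (U G) (c G)"
      "\<And>G. G \<in> \<G> \<Longrightarrow> G \<subseteq> c G ` (U G \<times> {0..<1})"
    using \<G>(3) by metis
  define W where "W G = subtopology ?Z (c G ` (U G \<times> {0..<1}) \<times> UNIV)" for G
  define pushes where "pushes G g g' h \<longleftrightarrow> homeomorphic_maps (W G) (W G) g g' \<and>
      (\<forall>p \<in> topspace (W G). g p \<noteq> p \<longrightarrow> 0 < \<psi>' G (fst p)) \<and>
      (\<forall>b \<in> U G. 0 \<le> h b \<and> h b \<le> \<psi>' G b \<and> (0 < \<psi>' G b \<longrightarrow> 0 < h b)) \<and>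
      (\<forall>b \<in> U G. \<forall>s \<le> - h b. g (b, s) = (b, s + h b))" for G g g' h
  have "\<exists>g g' h. pushes G g g' h" if G: "G \<in> \<G>" for G
    unfolding pushes_def W_def
    by (rule local_collar_push[OF B Uc(1)[OF G] \<psi>'cont[OF G]]) (use \<psi>(2) in \<open>force simp: \<psi>'_def\<close>, blast)
  then obtain g g' h where pushes: "\<And>G. G \<in> \<G> \<Longrightarrow> pushes G (g G) (g' G) (h G)"
    by metis
  have g: "homeomorphic_maps (W G) (W G) (g G) (g' G)"
    and gmov: "\<And>p. p \<in> topspace (W G) \<Longrightarrow> g G p \<noteq> p \<Longrightarrow> 0 < \<psi>' G (fst p)"
    and h: "\<And>b. b \<in> U G \<Longrightarrow> 0 \<le> h G b \<and> h G b \<le> \<psi>' G b \<and> (0 < \<psi>' G b \<longrightarrow> 0 < h G b)"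
    and gtrans: "\<And>b s. b \<in> U G \<Longrightarrow> s \<le> - h G b \<Longrightarrow> g G (b, s) = (b, s + h G b)"
    if "G \<in> \<G>" for G
    using pushes[OF that] unfolding pushes_def by simp_all
  have g'mov: "0 < \<psi>' G (fst p)" if "G \<in> \<G>" "p \<in> topspace (W G)" "g' G p \<noteq> p" for G p
    using g[OF that(1)] gmov[OF that(1,2)] that(2,3) unfolding homeomorphic_maps_def by metis
  define sel where "sel x = (SOME G. G \<in> \<G> \<and> x \<in> G)" for x
  have sel: "sel x = G" if "G \<in> \<G>" "x \<in> G" for x G
    using that same unfolding sel_def by (intro some_equality) blast+
  define glue where "glue \<gamma> p = (if fst p \<in> \<Union>\<G> then \<gamma> (sel (fst p)) p else p)"
    for \<gamma> :: "'a set \<Rightarrow> 'a \<times> real \<Rightarrow> 'a \<times> real" and p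
  have inW: "p \<in> topspace (W G)" if "G \<in> \<G>" "p \<in> topspace ?Z" "fst p \<in> G" for G p
    using that Uc(2) by (cases p) (auto simp: W_def)
  have glue: "continuous_map ?Z ?Z (glue \<gamma>)"
    if \<gamma>: "\<And>G. G \<in> \<G> \<Longrightarrow> continuous_map (W G) (W G) (\<gamma> G)"
      and mov: "\<And>G p. G \<in> \<G> \<Longrightarrow> p \<in> topspace (W G) \<Longrightarrow> \<gamma> G p \<noteq> p \<Longrightarrow> 0 < \<psi>' G (fst p)" for \<gamma>
  proof (rule pasting_lemma[where I = "insert None (Some ` \<G>)"
        and f = "\<lambda>i. case i of None \<Rightarrow> (\<lambda>p. p) | Some G \<Rightarrow> \<gamma> G"
        and T = "\<lambda>i. topspace ?Z \<inter> (case i of None \<Rightarrow> topspace X - F | Some G \<Rightarrow> G) \<times> UNIV"])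
    show "openin ?Z (topspace ?Z \<inter> (case i of None \<Rightarrow> topspace X - F | Some G \<Rightarrow> G) \<times> UNIV)"
      if "i \<in> insert None (Some ` \<G>)" for i
      using that \<G>(1) openin_diff[OF openin_topspace F(1)]
      by (intro openin_outer_collar_Times_UNIV) auto
    show "continuous_map (subtopology ?Z (topspace ?Z \<inter> (case i of None \<Rightarrow> topspace X - F | Some G \<Rightarrow> G) \<times> UNIV))
            ?Z (case i of None \<Rightarrow> (\<lambda>p. p) | Some G \<Rightarrow> \<gamma> G)" if i: "i \<in> insert None (Some ` \<G>)" for i
    proof (cases i)
      case None
      then show ?thesis
        by (simp add: continuous_map_from_subtopology)
    next
      case (Some G)
      then have G: "G \<in> \<G>"
        using i by auto
      have "continuous_map (W G) ?Z (\<gamma> G)"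
        using \<gamma>[OF G] unfolding W_def by (rule continuous_map_into_fulltopology)
      then have "continuous_map (subtopology ?Z (topspace ?Z \<inter> G \<times> UNIV)) ?Z (\<gamma> G)"
        unfolding W_def by (rule continuous_map_from_subtopology_mono) (use Uc(2)[OF G] in auto)
      then show ?thesis
        by (simp add: Some)
    qed
    show "(case i of None \<Rightarrow> (\<lambda>p. p) | Some G \<Rightarrow> \<gamma> G) p = (case j of None \<Rightarrow> (\<lambda>p. p) | Some G \<Rightarrow> \<gamma> G) p"
      if ij: "i \<in> insert None (Some ` \<G>)" "j \<in> insert None (Some ` \<G>)"
        and p: "p \<in> topspace ?Z \<inter> (topspace ?Z \<inter> (case i of None \<Rightarrow> topspace X - F | Some G \<Rightarrow> G) \<times> UNIV) \<inter>
             (topspace ?Z \<inter> (case j of None \<Rightarrow> topspace X - F | Some G \<Rightarrow> G) \<times> UNIV)" for i j p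
    proof -
      have "\<gamma> G p = p" if "G \<in> \<G>" "fst p \<in> G" "fst p \<in> topspace X - F" for G
        using mov[OF that(1) inW] that p F(3) by (fastforce simp: \<psi>'_def)
      then show ?thesis
        using ij p same by (auto split: option.splits)
    qed
    show "\<exists>j. j \<in> insert None (Some ` \<G>) \<and>
            p \<in> topspace ?Z \<inter> (case j of None \<Rightarrow> topspace X - F | Some G \<Rightarrow> G) \<times> UNIV \<and>
            glue \<gamma> p = (case j of None \<Rightarrow> (\<lambda>p. p) | Some G \<Rightarrow> \<gamma> G) p" if p: "p \<in> topspace ?Z" for p
    proof (cases "fst p \<in> \<Union>\<G>")
      case True
      then obtain G where "G \<in> \<G>" "fst p \<in> G"
        by blast
      then show ?thesis
        using p sel[of G "fst p"] by (intro exI[of _ "Some G"]) (cases p; auto simp: glue_def)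
    next
      case False
      then show ?thesis
        using p F(2) by (intro exI[of _ None]) (cases p; auto simp: glue_def topspace_outer_collar)
    qed
  qed
  \<comment> \<open>A moved point has a moved image, because the map is injective.\<close>
  have stays: "fst (\<gamma> p) \<in> G"
    if hom: "homeomorphic_maps (W G) (W G) \<gamma> \<gamma>'" and G: "G \<in> \<G>" "p \<in> topspace ?Z" "fst p \<in> G"
      and mov: "\<And>p. p \<in> topspace (W G) \<Longrightarrow> \<gamma> p \<noteq> p \<Longrightarrow> 0 < \<psi>' G (fst p)" for \<gamma> \<gamma>' G p
  proof (cases "\<gamma> p = p")
    case False
    have p: "p \<in> topspace (W G)"
      by (rule inW[OF G])
    then have q: "\<gamma> p \<in> topspace (W G)"
      using hom continuous_map_image_subset_topspace unfolding homeomorphic_maps_def by blast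
    have "\<gamma> (\<gamma> p) \<noteq> \<gamma> p"
    proof
      assume "\<gamma> (\<gamma> p) = \<gamma> p"
      then have "\<gamma>' (\<gamma> (\<gamma> p)) = \<gamma>' (\<gamma> p)"
        by simp
      then show False
        using False hom p q by (simp add: homeomorphic_maps_def)
    qed
    then show ?thesis
      using mov[OF q] by (auto simp: \<psi>'_def split: if_splits)
  qed (use G in simp)
  have inv: "glue \<gamma>' (glue \<gamma> p) = p"
    if hom: "\<And>G. G \<in> \<G> \<Longrightarrow> homeomorphic_maps (W G) (W G) (\<gamma> G) (\<gamma>' G)" and p: "p \<in> topspace ?Z"
      and mov: "\<And>G p. G \<in> \<G> \<Longrightarrow> p \<in> topspace (W G) \<Longrightarrow> \<gamma> G p \<noteq> p \<Longrightarrow> 0 < \<psi>' G (fst p)" for \<gamma> \<gamma>' p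
  proof (cases "fst p \<in> \<Union>\<G>")
    case True
    then obtain G where G: "G \<in> \<G>" "fst p \<in> G"
      by blast
    then have "fst (\<gamma> G p) \<in> G"
      using stays[OF hom[OF G(1)] G(1) p G(2) mov[OF G(1)]] by blast
    then have "glue \<gamma>' (glue \<gamma> p) = \<gamma>' G (\<gamma> G p)"
      using G sel[OF G(1)] by (auto simp: glue_def)
    then show ?thesis
      using hom[OF G(1)] inW[OF G(1) p G(2)] unfolding homeomorphic_maps_def by simp
  qed (simp add: glue_def)
  have hom': "homeomorphic_maps (W G) (W G) (g' G) (g G)" if "G \<in> \<G>" for G
    using g[OF that] homeomorphic_maps_sym by blast
  have "homeomorphic_maps ?Z ?Z (glue g) (glue g')"
    unfolding homeomorphic_maps_def
  proof (intro conjI ballI)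
    show "continuous_map ?Z ?Z (glue g)" "continuous_map ?Z ?Z (glue g')"
      using g gmov g'mov by (auto simp: homeomorphic_maps_def intro!: glue)
    show "glue g' (glue g p) = p" if "p \<in> topspace ?Z" for p
      by (rule inv[OF g that gmov])
    show "glue g (glue g' p) = p" if "p \<in> topspace ?Z" for p
      by (rule inv[OF hom' that g'mov])
  qed
  then have hom: "homeomorphic_map ?Z ?Z (glue g)"
    using homeomorphic_map_maps by blast
  define k where "k b = (if b \<in> \<Union>\<G> then h (sel b) b else 0)" for b
  have inU: "b \<in> U G" if "b \<in> B" "G \<in> \<G>" "b \<in> G" for b G
    using local_collar_image_Int[OF Uc(1)] Uc(2) that by blast
  show thesis
  proof
    show "homeomorphic_map ?Z ?Z (glue g)"
      by (rule hom)
    show "0 \<le> k b \<and> k b \<le> \<psi> b \<and> (0 < \<psi> b \<longrightarrow> 0 < k b)" if b: "b \<in> B" for b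
    proof (cases "b \<in> \<Union>\<G>")
      case True
      then obtain G where G: "G \<in> \<G>" "b \<in> G"
        by blast
      then show ?thesis
        using h[OF G(1) inU[OF b G]] sel[OF G] by (auto simp: k_def \<psi>'_def)
    next
      case False
      then have "b \<in> topspace X - F"
        using b F(2) closedin_subset[OF B] by blast
      then show ?thesis
        using False F(3)[of b] by (simp add: k_def)
    qed
    show "glue g (b, s) = (b, s + k b)" if b: "b \<in> B" and s: "s \<le> - k b" for b s
    proof (cases "b \<in> \<Union>\<G>")
      case True
      then obtain G where G: "G \<in> \<G>" "b \<in> G"
        by blast
      have "k b = h G b" "glue g (b, s) = g G (b, s)"
        using True sel[OF G] by (simp_all add: k_def glue_def)
      then show ?thesis
        using gtrans[OF G(1) inU[OF b G], of s] s by simp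
    qed (simp add: k_def glue_def)
  qed
qed

section \<open>From pushes to a collar\<close>

section \<open>Composing the pushes\<close>

lemma openin_outer_collar_strictly_negative:
  assumes B: "B \<subseteq> topspace X"
    and S: "openin (prod_topology (subtopology X B) euclideanreal) S" "S \<subseteq> UNIV \<times> {..<0}"
  shows "openin (outer_collar X B) S"
proof -
  obtain T where T: "openin (prod_topology X euclideanreal) T" "S = T \<inter> B \<times> UNIV"
    using S(1) unfolding prod_topology_subtopology openin_subtopology by auto
  have "openin (prod_topology X euclideanreal) (topspace X \<times> {..<0})"
    by (simp add: openin_prod_Times_iff)
  then have "openin (prod_topology X euclideanreal) (T \<inter> topspace X \<times> {..<0})"
    by (rule openin_Int[OF T(1)])
  moreover have "S = (T \<inter> topspace X \<times> {..<0}) \<inter> {p. snd p = 0 \<or> fst p \<in> B \<and> snd p \<le> 0}"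
    using T(2) S(2) B by auto
  ultimately show ?thesis
    unfolding outer_collar_def openin_subtopology by blast
qed

text \<open>A collar of variable length \<open>f\<close> which extends the outer collar. Rescaling its fibres by \<open>f / 2\<close>
  keeps the closed cylinder \<open>B \<times> [0, 1]\<close> inside the open domain of \<open>\<kappa>\<close>. Since \<open>\<kappa>\<close> is injective and
  the points at negative heights are images of themselves, nonnegative heights can only be mapped to
  the copy of \<open>X\<close>, and only \<open>B \<times> {0}\<close> to the copy of \<open>B\<close>.\<close>
lemma collared_if_long_collar:
  assumes B: "closedin X B"
    and f: "continuous_map (subtopology X B) euclideanreal f" "\<And>b. b \<in> B \<Longrightarrow> 0 < f b"
  defines "D \<equiv> subtopology (prod_topology (subtopology X B) euclideanreal) {p. snd p < f (fst p)}"
  assumes \<kappa>: "continuous_map D (outer_collar X B) \<kappa>" "open_map D (outer_collar X B) \<kappa>"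
      "inj_on \<kappa> (topspace D)"
    and \<kappa>_neg: "\<And>b t. b \<in> B \<Longrightarrow> t \<le> 0 \<Longrightarrow> \<kappa> (b, t) = (b, t)"
  shows "collared X B"
proof -
  let ?Z = "outer_collar X B"
  let ?C = "prod_topology (subtopology X B) (top_of_set {0..1::real})"
  let ?BR = "prod_topology (subtopology X B) euclideanreal"
  have BX: "B \<subseteq> topspace X"
    using closedin_subset[OF B] .
  then have topC: "topspace ?C = B \<times> {0..1}" and topBR: "topspace ?BR = B \<times> UNIV"
    by auto
  have topD: "topspace D = {p. fst p \<in> B \<and> snd p < f (fst p)}"
    using BX by (auto simp: D_def)
  define m where "m p = (fst p, snd p * (f (fst p) / 2))" for p :: "'a \<times> real"
  define m' where "m' p = (fst p, snd p / (f (fst p) / 2))" for p :: "'a \<times> real"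
  have half: "continuous_map (subtopology X B) euclideanreal (\<lambda>b. f b / 2)"
    using continuous_map_real_mult_right[OF f(1), of "1/2"] by simp
  have half_fst: "continuous_map Y euclideanreal (\<lambda>p. f (fst p) / 2)"
    if "continuous_map Y (subtopology X B) fst" for Y :: "('a \<times> real) topology"
    using continuous_map_compose[OF that half] by (simp add: o_def)
  have mC: "continuous_map ?C ?BR m"
    unfolding m_def
    by (intro continuous_map_pairedI continuous_map_real_mult half_fst continuous_map_fst
        continuous_map_into_fulltopology[OF continuous_map_snd])
  have m'BR: "continuous_map ?BR ?BR m'"
  proof -
    have "f (fst p) / 2 \<noteq> 0" if "p \<in> topspace ?BR" for p
      using f(2)[of "fst p"] that topBR by auto
    then have "continuous_map ?BR euclideanreal (\<lambda>p. snd p / (f (fst p) / 2))"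
      by (rule continuous_map_real_divide[OF continuous_map_snd half_fst[OF continuous_map_fst]])
    then show ?thesis
      unfolding m'_def by (rule continuous_map_pairedI[OF continuous_map_fst])
  qed
  have m_less: "snd p * (f (fst p) / 2) < f (fst p)" if "fst p \<in> B" "snd p \<le> 1" for p :: "'a \<times> real"
    using f(2)[OF that(1)] mult_right_mono[OF that(2), of "f (fst p) / 2"] by simp
  have m'm: "m' (m p) = p" if "fst p \<in> B" for p
    using f(2)[OF that] by (cases p) (auto simp: m_def m'_def)
  have mm': "m (m' p) = p" if "fst p \<in> B" for p
    using f(2)[OF that] by (cases p) (auto simp: m_def m'_def)
  have emb_m: "embedding_map ?C D m"
  proof -
    have "embedding_map ?C ?BR m"
      unfolding embedding_map_def homeomorphic_map_maps
    proof (intro exI[of _ m'] , unfold homeomorphic_maps_def, intro conjI ballI)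
      show "continuous_map ?C (subtopology ?BR (m ` topspace ?C)) m"
        by (rule continuous_map_into_subtopology[OF mC]) auto
      have "continuous_map (subtopology ?BR (m ` topspace ?C)) ?BR m'"
        by (rule continuous_map_from_subtopology[OF m'BR])
      moreover have "m' p \<in> B \<times> {0..1}" if "p \<in> topspace (subtopology ?BR (m ` topspace ?C))" for p
        using that m'm topC by auto
      ultimately have "continuous_map (subtopology ?BR (m ` topspace ?C)) (subtopology ?BR (B \<times> {0..1})) m'"
        by (intro continuous_map_into_subtopology) auto
      then show "continuous_map (subtopology ?BR (m ` topspace ?C)) ?C m'"
        by (simp add: subtopology_Times subtopology_subtopology)
    qed (use m'm mm' topC in auto)
    then show ?thesis
      unfolding D_def embedding_map_in_subtopology using m_less topC by (force simp: m_def)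
  qed
  have emb_\<kappa>: "embedding_map D ?Z \<kappa>"
    by (rule injective_open_imp_embedding_map[OF \<kappa>])
  have \<kappa>Z: "\<kappa> p \<in> topspace ?Z" if "p \<in> topspace D" for p
    using continuous_map_image_subset_topspace[OF \<kappa>(1)] that by blast
  have \<kappa>_pos: "snd (\<kappa> (b, t)) = 0" if b: "b \<in> B" "0 \<le> t" "t < f b" for b t
  proof (rule ccontr)
    assume neg: "snd (\<kappa> (b, t)) \<noteq> 0"
    have D: "(b, t) \<in> topspace D"
      using b topD by simp
    define q where "q = \<kappa> (b, t)"
    have q: "fst q \<in> B" "snd q < 0"
      using \<kappa>Z[OF D] neg by (auto simp: topspace_outer_collar q_def)
    then have "q \<in> topspace D"
      using f(2)[of "fst q"] topD by simp
    moreover have "\<kappa> q = \<kappa> (b, t)"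
      using \<kappa>_neg[of "fst q" "snd q"] q by (simp add: q_def)
    ultimately have "q = (b, t)"
      using inj_onD[OF \<kappa>(3) _ _ D] by blast
    then show False
      using q b by simp
  qed
  have \<kappa>_B: "t = 0" if b: "b \<in> B" "0 \<le> t" "t < f b" "fst (\<kappa> (b, t)) \<in> B" for b t
  proof -
    define b' where "b' = fst (\<kappa> (b, t))"
    have "\<kappa> (b, t) = (b', 0)"
      using \<kappa>_pos[OF b(1-3)] by (simp add: b'_def prod_eq_iff)
    moreover have "\<kappa> (b', 0) = (b', 0)"
      using \<kappa>_neg b(4) by (simp add: b'_def)
    moreover have "(b, t) \<in> topspace D" "(b', 0) \<in> topspace D"
      using b f(2) topD by (auto simp: b'_def)
    ultimately have "(b, t) = (b', 0)"
      using inj_onD[OF \<kappa>(3)] by metis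
    then show ?thesis
      by simp
  qed
  define c where "c = fst \<circ> (\<kappa> \<circ> m)"
  have c_eq: "c (b, t) = fst (\<kappa> (b, t * (f b / 2)))" for b t
    by (simp add: c_def m_def)
  have bound: "0 \<le> t * (f b / 2)" "t * (f b / 2) < f b" if "b \<in> B" "0 \<le> t" "t \<le> 1" for b t
    using f(2)[OF that(1)] that m_less[of "(b, t)"] by auto
  show ?thesis
    unfolding collared_def local_collar_def closure_of_closedin[OF B]
  proof (intro exI[of _ c] conjI ballI)
    show "openin (subtopology X B) B"
      using BX by (metis inf.absorb_iff2 openin_topspace topspace_subtopology)
    have "embedding_map ?C ?Z (\<kappa> \<circ> m)"
      by (rule embedding_map_compose[OF emb_m emb_\<kappa>])
    moreover have "(\<kappa> \<circ> m) ` topspace ?C \<subseteq> UNIV \<times> {0}"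
    proof (rule image_subsetI)
      fix p
      assume "p \<in> topspace ?C"
      then have "fst p \<in> B" "0 \<le> snd p" "snd p \<le> 1"
        unfolding topC by auto
      then show "(\<kappa> \<circ> m) p \<in> UNIV \<times> {0}"
        using \<kappa>_pos[OF _ bound] by (simp add: m_def mem_Times_iff)
    qed
    ultimately have 1: "embedding_map ?C (subtopology ?Z (UNIV \<times> {0})) (\<kappa> \<circ> m)"
      by (simp add: embedding_map_in_subtopology)
    have "homeomorphic_maps (subtopology ?Z (UNIV \<times> {0})) X fst (\<lambda>x. (x, 0))"
      unfolding homeomorphic_maps_def
      by (auto simp: continuous_map_in_subtopology continuous_map_into_outer_collar topspace_outer_collar
          intro: continuous_map_from_subtopology[OF continuous_map_fst_outer_collar])
    then have "embedding_map (subtopology ?Z (UNIV \<times> {0})) X fst"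
      by (intro section_imp_embedding_map) (auto simp: section_map_def retraction_maps_def homeomorphic_maps_def)
    from embedding_map_compose[OF 1 this] show "embedding_map ?C X c"
      by (simp add: c_def)
    show "c (x, 0) = x" if "x \<in> B" for x
      using \<kappa>_neg[OF that, of 0] by (simp add: c_eq)
    show "{p \<in> B \<times> {0..1}. c p \<in> B} = B \<times> {0}"
    proof (intro equalityI subsetI)
      fix p
      assume "p \<in> {p \<in> B \<times> {0..1}. c p \<in> B}"
      then obtain b t where p: "p = (b, t)" "b \<in> B" "0 \<le> t" "t \<le> 1" "c (b, t) \<in> B"
        by auto
      then have "t * (f b / 2) = 0"
        using \<kappa>_B[OF p(2) bound[OF p(2-4)]] by (simp add: c_eq)
      then show "p \<in> B \<times> {0}"
        using f(2)[OF p(2)] p by auto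
    next
      fix p
      assume "p \<in> B \<times> {0::real}"
      then show "p \<in> {p \<in> B \<times> {0..1}. c p \<in> B}"
        using \<kappa>_neg[of "fst p" 0] by (auto simp: c_eq)
    qed
    have "openin D (topspace D \<inter> {p \<in> topspace ?BR. snd (m' p) \<in> {..<1}})"
      unfolding D_def topspace_subtopology
      using openin_continuous_map_preimage[OF continuous_map_compose[OF m'BR continuous_map_snd], of "{..<1}"]
      by (auto simp: openin_subtopology o_def)
    then have "openin ?Z (\<kappa> ` (topspace D \<inter> {p \<in> topspace ?BR. snd (m' p) \<in> {..<1}}))" (is "openin _ ?O")
      using \<kappa>(2) unfolding open_map_def by blast
    moreover have "continuous_map X ?Z (\<lambda>x. (x, 0))"
      by (auto simp: continuous_map_into_outer_collar)
    ultimately have "openin X {x \<in> topspace X. (x, 0) \<in> ?O}"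
      by (rule openin_continuous_map_preimage[rotated])
    also have "{x \<in> topspace X. (x, 0) \<in> ?O} = c ` (B \<times> {0..<1})"
    proof (intro equalityI subsetI)
      fix x
      assume "x \<in> {x \<in> topspace X. (x, 0) \<in> ?O}"
      then obtain b u where u: "(x, 0) = \<kappa> (b, u)" "b \<in> B" "u < f b" "u / (f b / 2) < 1"
        by (auto simp: topD m'_def)
      have "0 \<le> u"
        using \<kappa>_neg[OF u(2), of u] u(1) by (cases "u < 0") auto
      then have "x = c (b, u / (f b / 2))" "u / (f b / 2) \<in> {0..<1}"
        using u f(2)[OF u(2)] by (auto simp: c_eq simp flip: u(1))
      then show "x \<in> c ` (B \<times> {0..<1})"
        using u(2) by blast
    next
      fix x
      assume "x \<in> c ` (B \<times> {0..<1})"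
      then obtain b t where x: "x = c (b, t)" "b \<in> B" "0 \<le> t" "t < 1"
        by auto
      define u where "u = t * (f b / 2)"
      have u: "0 \<le> u" "u < f b" "snd (m' (b, u)) < 1"
        using bound[of b t] x f(2)[of b] by (auto simp: u_def m'_def)
      have "(x, 0) = \<kappa> (b, u)"
        using \<kappa>_pos[OF x(2) u(1,2)] x by (simp add: c_eq u_def prod_eq_iff)
      moreover have "(b, u) \<in> topspace D"
        using u x topD by simp
      ultimately show "x \<in> {x \<in> topspace X. (x, 0) \<in> ?O}"
      proof -
        assume *: "(x, 0) = \<kappa> (b, u)" "(b, u) \<in> topspace D"
        then have "(x, 0) \<in> topspace ?Z"
          using \<kappa>Z by simp
        then have "x \<in> topspace X"
          by (simp add: topspace_outer_collar)
        moreover have "(b, u) \<in> topspace D \<inter> {p \<in> topspace ?BR. snd (m' p) \<in> {..<1}}"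
          using * u x(2) topBR by simp
        then have "(x, 0) \<in> ?O"
          by (subst *(1)) (rule imageI)
        ultimately show ?thesis
          by (intro CollectI conjI)
      qed
    qed
    finally show "openin X (c ` (B \<times> {0..<1}))" .
  qed
qed

text \<open>The bound \<open>(1/2) ^ n\<close> makes the total length \<open>\<Sum>n. h n b\<close> converge uniformly, hence depend
  continuously on \<open>b\<close>.\<close>
lemma collared_if_pushes:
  assumes B: "closedin X B"
    and \<tau>: "\<And>n. homeomorphic_map (outer_collar X B) (outer_collar X B) (\<tau> n)"
    and h: "\<And>n b. b \<in> B \<Longrightarrow> 0 \<le> h n b \<and> h n b \<le> (1/2) ^ n"
    and pos: "\<And>b. b \<in> B \<Longrightarrow> \<exists>n. 0 < h n b"
    and trans: "\<And>n b s. b \<in> B \<Longrightarrow> s \<le> - h n b \<Longrightarrow> \<tau> n (b, s) = (b, s + h n b)"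
  shows "collared X B"
proof -
  let ?Z = "outer_collar X B"
  let ?BR = "prod_topology (subtopology X B) euclideanreal"
  have BX: "B \<subseteq> topspace X"
    using closedin_subset[OF B] .
  then have topBR: "topspace ?BR = B \<times> UNIV"
    by auto
  \<comment> \<open>As \<open>h n \<le> 1\<close>, the push acts as a translation at height \<open>-1\<close>, where \<open>h n\<close> can be read off.\<close>
  have hcont: "continuous_map (subtopology X B) euclideanreal (h n)" for n
  proof -
    have "continuous_map (subtopology X B) ?Z (\<lambda>b. (b, -1))"
      by (auto simp: continuous_map_into_outer_collar continuous_map_from_subtopology)
    then have "continuous_map (subtopology X B) ?Z (\<lambda>b. \<tau> n (b, -1))"
      using continuous_map_compose[OF _ homeomorphic_imp_continuous_map[OF \<tau>]] by (simp add: o_def)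
    then have "continuous_map (subtopology X B) euclideanreal (\<lambda>b. snd (\<tau> n (b, -1)) + 1)"
      by (auto simp: continuous_map_into_outer_collar intro: continuous_map_add)
    moreover have "snd (\<tau> n (b, -1)) + 1 = h n b" if "b \<in> topspace (subtopology X B)" for b
    proof -
      have "h n b \<le> 1"
        using h[of b n] that power_le_one[of "1/2::real" n] by auto
      then show ?thesis
        using trans[of b "-1" n] that by auto
    qed
    ultimately show ?thesis
      using continuous_map_eq by blast
  qed
  define T where "T = rec_nat id (\<lambda>n S. S \<circ> \<tau> n)"
  have T_0: "T 0 = id" and T_Suc: "T (Suc n) = T n \<circ> \<tau> n" for n
    by (simp_all add: T_def)
  have T: "homeomorphic_map ?Z ?Z (T n)" for n
  proof (induction n)
    case 0
    show ?case
      by (simp only: T_0 homeomorphic_map_id)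
  next
    case (Suc n)
    show ?case
      unfolding T_Suc by (rule homeomorphic_map_compose[OF \<tau> Suc.IH])
  qed
  define F where "F n b = (\<Sum>i<n. h i b)" for n b
  have F_mono: "F n b \<le> F k b" if "b \<in> B" "n \<le> k" for n k b
    unfolding F_def by (rule sum_mono2) (use h that in auto)
  have Fcont: "continuous_map (subtopology X B) euclideanreal (F n)" for n
    unfolding F_def by (intro continuous_map_sum hcont) auto
  have T_trans: "T n (b, s) = (b, s + F n b)" if b: "b \<in> B" and "s \<le> - F n b" for n b s
    using that(2)
  proof (induction n arbitrary: s)
    case (Suc n)
    have "F (Suc n) b = F n b + h n b"
      by (simp add: F_def)
    moreover have "0 \<le> F n b"
      using F_mono[OF b, of 0 n] by (simp add: F_def)
    ultimately show ?case
      using Suc.prems Suc.IH[of "s + h n b"] trans[OF b, of s n] by (simp add: T_Suc)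
  qed (simp add: T_0 F_def)
  \<comment> \<open>A later factor acts first, at heights where it merely cancels the change of \<open>F\<close>.\<close>
  have T_stable: "T k (b, t - F k b) = T n (b, t - F n b)" if b: "b \<in> B" and "n \<le> k" "t \<le> F n b" for n k b t
    using that(2)
  proof (induction k rule: dec_induct)
    case (step k)
    have "T (Suc k) (b, t - F (Suc k) b) = T k (\<tau> k (b, t - F (Suc k) b))"
      by (simp add: T_Suc)
    also have "\<tau> k (b, t - F (Suc k) b) = (b, t - F k b)"
      using trans[OF b, of "t - F (Suc k) b" k] F_mono[OF b step(1)] that(3) by (simp add: F_def)
    finally show ?case
      using step.IH by simp
  qed simp
  have h_summable: "summable (\<lambda>i. h i b)" if "b \<in> B" for b
    by (rule summable_comparison_test'[of "\<lambda>i. (1/2::real) ^ i" 0]) (use h[OF that] in auto)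
  define f where "f b = (\<Sum>i. h i b)" for b
  have F_f: "(\<lambda>n. F n b) \<longlonglongrightarrow> f b" if "b \<in> B" for b
    using summable_LIMSEQ[OF h_summable[OF that]] by (simp add: F_def f_def)
  have fcont: "continuous_map (subtopology X B) euclideanreal f"
  proof -
    have unif: "uniform_limit B F f sequentially"
      unfolding F_def f_def
      by (rule Weierstrass_m_test[where M = "\<lambda>i. (1/2) ^ i"]) (use h in auto)
    have "continuous_map (subtopology X B) Met_TC.mtopology f"
    proof (rule Met_TC.continuous_map_uniform_limit[where F = sequentially and f = F])
      show "\<forall>\<^sub>F n in sequentially. \<forall>b\<in>topspace (subtopology X B). f b \<in> UNIV \<and> dist (F n b) (f b) < \<epsilon>"
        if "0 < \<epsilon>" for \<epsilon>
        using uniform_limitD[OF unif that] by (rule eventually_mono) auto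
    qed (use Fcont in auto)
    then show ?thesis
      by simp
  qed
  have fpos: "0 < f b" if b: "b \<in> B" for b
  proof -
    obtain n where "0 < h n b"
      using pos[OF b] by blast
    then show ?thesis
      unfolding f_def by (intro suminf_pos2[OF h_summable[OF b]]) (use h[OF b] in auto)
  qed
  define D where "D = subtopology ?BR {p. snd p < f (fst p)}"
  define E where "E n = {p \<in> topspace ?BR. snd p < F n (fst p)}" for n
  define \<sigma> where "\<sigma> n p = (fst p, snd p - F n (fst p))" for n and p :: "'a \<times> real"
  have F_less: "\<exists>n. t < F n b" if "b \<in> B" "t < f b" for b t
    using order_tendstoD(1)[OF F_f[OF that(1)] that(2)] eventually_happens by fastforce
  have F_le: "F n b \<le> f b" if "b \<in> B" for n b
    unfolding F_def f_def by (rule sum_le_suminf[OF h_summable[OF that]]) (use h[OF that] in auto)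
  \<comment> \<open>The least index is an arbitrary choice: every \<open>n\<close> with \<open>p \<in> E n\<close> gives the same value.\<close>
  define \<kappa> where "\<kappa> p = (let n = (LEAST n. snd p < F n (fst p)) in T n (\<sigma> n p))" for p
  have \<kappa>: "\<kappa> p = T n (\<sigma> n p)" if "p \<in> E n" for n p
  proof -
    define k where "k = (LEAST n. snd p < F n (fst p))"
    have p: "fst p \<in> B" "snd p < F n (fst p)"
      using that by (auto simp: E_def topBR)
    then have "k \<le> n" "snd p < F k (fst p)"
      using Least_le LeastI by (auto simp: k_def)
    then have "T n (fst p, snd p - F n (fst p)) = T k (fst p, snd p - F k (fst p))"
      using T_stable[OF p(1), of k n "snd p"] by simp
    then show ?thesis
      by (simp add: \<kappa>_def \<sigma>_def flip: k_def)
  qed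
  have topD: "topspace D = (\<Union>n. E n)"
  proof (intro equalityI subsetI)
    fix p
    assume "p \<in> topspace D"
    then have "fst p \<in> B" "snd p < f (fst p)"
      unfolding D_def topspace_subtopology topBR by auto
    then show "p \<in> (\<Union>n. E n)"
      using F_less[of "fst p" "snd p"] unfolding E_def topBR by (auto simp: mem_Times_iff)
  next
    fix p
    assume "p \<in> (\<Union>n. E n)"
    then obtain n where "fst p \<in> B" "snd p < F n (fst p)"
      unfolding E_def topBR by auto
    then show "p \<in> topspace D"
      using F_le[of "fst p" n] unfolding D_def topspace_subtopology topBR by (auto simp: mem_Times_iff)
  qed
  have E_mono: "E n \<subseteq> E k" if "n \<le> k" for n k
  proof
    fix p
    assume "p \<in> E n"
    then show "p \<in> E k"
      using F_mono[OF _ that, of "fst p"] unfolding E_def topBR by (auto simp: mem_Times_iff)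
  qed
  have \<sigma>hom: "homeomorphic_maps ?BR ?BR (\<sigma> n) (\<lambda>p. (fst p, snd p + F n (fst p)))" for n
  proof -
    have "continuous_map ?BR euclideanreal (\<lambda>p. F n (fst p))"
      using continuous_map_compose[OF continuous_map_fst Fcont] by (simp add: o_def)
    then show ?thesis
      unfolding \<sigma>_def homeomorphic_maps_def
      by (auto simp: continuous_map_paired
          intro!: continuous_map_fst continuous_map_snd continuous_map_diff continuous_map_add)
  qed
  have Eopen: "openin ?BR (E n)" for n
  proof -
    have E: "E n = {p \<in> topspace ?BR. (snd \<circ> \<sigma> n) p \<in> {..<0}}"
      by (auto simp: E_def \<sigma>_def)
    have "continuous_map ?BR euclideanreal (snd \<circ> \<sigma> n)"
      using \<sigma>hom continuous_map_compose[OF _ continuous_map_snd] unfolding homeomorphic_maps_def by blast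
    then show ?thesis
      unfolding E by (rule openin_continuous_map_preimage) simp
  qed
  have \<sigma>E: "\<sigma> n p \<in> topspace ?Z" if "p \<in> E n" for n p
    using that BX by (auto simp: E_def \<sigma>_def topspace_outer_collar topBR)
  have \<sigma>inj: "p = q" if "\<sigma> n p = \<sigma> n q" for n p q
    using that by (auto simp: \<sigma>_def prod_eq_iff)
  have DE: "openin D (E n)" for n
    using Eopen[of n] topD unfolding D_def by (auto simp: openin_subtopology intro!: exI[of _ "E n"])
  have open_BR: "openin ?BR O'" if O': "openin D O'" for O'
  proof -
    have "openin ?BR (topspace D)"
      unfolding topD using Eopen by blast
    moreover obtain S where "openin ?BR S" "O' = S \<inter> {p. snd p < f (fst p)}"
      using O' unfolding D_def openin_subtopology by blast
    moreover have "O' \<subseteq> topspace D" "topspace D \<subseteq> {p. snd p < f (fst p)}"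
      using openin_subset[OF O'] unfolding D_def by auto
    ultimately have "openin ?BR (S \<inter> topspace D)" "O' = S \<inter> topspace D"
      by blast+
    then show ?thesis
      by simp
  qed
  show ?thesis
  proof (rule collared_if_long_collar[OF B fcont fpos, folded D_def])
    show "continuous_map D ?Z \<kappa>"
    proof (rule pasting_lemma[where I = UNIV and T = E and f = "\<lambda>n. T n \<circ> \<sigma> n"])
      show "continuous_map (subtopology D (E n)) ?Z (T n \<circ> \<sigma> n)" for n
      proof (rule continuous_map_compose[OF _ homeomorphic_imp_continuous_map[OF T]])
        have "continuous_map ?BR ?BR (\<sigma> n)"
          using \<sigma>hom unfolding homeomorphic_maps_def by blast
        then have "continuous_map (subtopology D (E n)) ?BR (\<sigma> n)"
          unfolding D_def by (intro continuous_map_from_subtopology)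
        then have "continuous_map (subtopology D (E n)) (prod_topology X euclideanreal) (\<sigma> n)"
          unfolding prod_topology_subtopology by (rule continuous_map_into_fulltopology)
        then show "continuous_map (subtopology D (E n)) ?Z (\<sigma> n)"
          unfolding outer_collar_def
          by (rule continuous_map_into_subtopology) (use \<sigma>E in \<open>auto simp: topspace_outer_collar\<close>)
      qed
      show "(T n \<circ> \<sigma> n) p = (T k \<circ> \<sigma> k) p" if "p \<in> topspace D \<inter> E n \<inter> E k" for n k p
        using that \<kappa>[of p n] \<kappa>[of p k] by simp
      show "\<exists>n. n \<in> UNIV \<and> p \<in> E n \<and> \<kappa> p = (T n \<circ> \<sigma> n) p" if p: "p \<in> topspace D" for p
      proof -
        obtain n where "p \<in> E n"
          using p unfolding topD by blast
        then show ?thesis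
          using \<kappa>[of p n] by (intro exI[of _ n]) simp
      qed
    qed (rule DE)
    show "open_map D ?Z \<kappa>"
      unfolding open_map_def
    proof (intro allI impI)
      fix O'
      assume O': "openin D O'"
      have "openin ?Z (T n ` \<sigma> n ` (O' \<inter> E n))" for n
      proof -
        have "openin ?BR (\<sigma> n ` (O' \<inter> E n))"
          using \<sigma>hom[of n] openin_Int[OF open_BR[OF O'] Eopen[of n]]
          by (meson homeomorphic_imp_open_map homeomorphic_maps_map open_map_def)
        then have "openin ?Z (\<sigma> n ` (O' \<inter> E n))"
          by (rule openin_outer_collar_strictly_negative[OF BX]) (auto simp: \<sigma>_def E_def)
        then show ?thesis
          using homeomorphic_imp_open_map[OF T] unfolding open_map_def by blast
      qed
      moreover have "\<kappa> ` O' = (\<Union>n. T n ` \<sigma> n ` (O' \<inter> E n))"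
      proof -
        have "\<kappa> ` O' = (\<Union>n. \<kappa> ` (O' \<inter> E n))"
          using openin_subset[OF O'] topD by blast
        also have "\<dots> = (\<Union>n. T n ` \<sigma> n ` (O' \<inter> E n))"
          using \<kappa> by (force simp: image_image)
        finally show ?thesis .
      qed
      ultimately show "openin ?Z (\<kappa> ` O')"
        by auto
    qed
    show "inj_on \<kappa> (topspace D)"
    proof (rule inj_onI)
      fix p q
      assume pq: "p \<in> topspace D" "q \<in> topspace D" "\<kappa> p = \<kappa> q"
      then obtain i j where "p \<in> E i" "q \<in> E j"
        using topD by auto
      then have E: "p \<in> E (max i j)" "q \<in> E (max i j)"
        using E_mono[of i "max i j"] E_mono[of j "max i j"] by auto
      then have "T (max i j) (\<sigma> (max i j) p) = T (max i j) (\<sigma> (max i j) q)"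
        using pq(3) \<kappa> by metis
      then have "\<sigma> (max i j) p = \<sigma> (max i j) q"
        using inj_onD[OF homeomorphic_imp_injective_map[OF T]] \<sigma>E E by metis
      then show "p = q"
        by (rule \<sigma>inj)
    qed
    show "\<kappa> (b, t) = (b, t)" if b: "b \<in> B" "t \<le> 0" for b t
    proof -
      obtain n where "t < F n b"
        using F_less[OF b(1), of t] fpos[OF b(1)] b(2) by auto
      then have "\<kappa> (b, t) = T n (b, t - F n b)"
        using \<kappa>[of "(b, t)" n] b BX by (auto simp: E_def topBR \<sigma>_def)
      then show ?thesis
        using T_trans[OF b(1), of "t - F n b" n] b by simp
    qed
  qed
qed

section \<open>The collaring theorem\<close>

theorem corollary4p4:
  fixes X :: "'a topology" and B :: "'a set"
  assumes "paracompact_space X"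
    and "Hausdorff_space X"
    and "closedin X B"
    and "locally_collared X B"
  shows "collared X B"
proof -
  note X = assms(1) and H = assms(2) and B = assms(3)
  define \<C> where "\<C> = {c ` (U \<times> {0..<1}) | U c. local_collar X B U c}"
  have \<C>: "\<exists>V\<in>\<C>. b \<in> V" if b: "b \<in> B" for b
  proof -
    obtain U c where U: "b \<in> U" and c: "local_collar X B U c"
      using assms(4) b unfolding locally_collared_def by blast
    then have "b \<in> c ` (U \<times> {0..<1})"
      using local_collar_image_Int[OF c] by blast
    moreover have "c ` (U \<times> {0..<1}) \<in> \<C>"
      using c unfolding \<C>_def by blast
    ultimately show ?thesis
      by (rule bexI)
  qed
  have op: "\<forall>V\<in>insert (topspace X - B) \<C>. openin X V"
  proof (rule ballI, elim insertE)
    fix V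
    assume "V = topspace X - B"
    then show "openin X V"
      using openin_diff[OF openin_topspace B] by simp
  next
    fix V
    assume "V \<in> \<C>"
    then show "openin X V"
      unfolding \<C>_def local_collar_def by blast
  qed
  moreover have "\<Union>(insert (topspace X - B) \<C>) = topspace X"
  proof
    show "\<Union>(insert (topspace X - B) \<C>) \<subseteq> topspace X"
      using op openin_subset by blast
    show "topspace X \<subseteq> \<Union>(insert (topspace X - B) \<C>)"
      using \<C> by blast
  qed
  ultimately show ?thesis
  proof (rule paracompact_sigma_disjoint_refinement[OF X H])
    fix A :: "nat \<Rightarrow> 'a set" and \<G> :: "nat \<Rightarrow> 'a set set"
    assume A: "\<And>n. closedin X (A n)" "topspace X = (\<Union>n. A n)" "\<And>n. A n \<subseteq> \<Union>(\<G> n)"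
      and \<G>: "\<And>n G. G \<in> \<G> n \<Longrightarrow> openin X G" "\<And>n. pairwise disjnt (\<G> n)"
        "\<And>n G. G \<in> \<G> n \<Longrightarrow> \<exists>U\<in>insert (topspace X - B) \<C>. G \<subseteq> U"
    define pushes where "pushes n \<tau> h \<longleftrightarrow>
        homeomorphic_map (outer_collar X B) (outer_collar X B) \<tau> \<and>
        (\<forall>b\<in>B. (0 \<le> h b \<and> h b \<le> (1/2) ^ n) \<and> (b \<in> A n \<longrightarrow> 0 < h b) \<and>
          (\<forall>s \<le> - h b. \<tau> (b, s) = (b, s + h b)))" for n \<tau> and h :: "'a \<Rightarrow> real"
    have "\<exists>\<tau> h. pushes n \<tau> h" for n
    proof -
      \<comment> \<open>The members that carry a push. They cover \<open>A n \<inter> B\<close>, as all others lie in \<open>X - B\<close>.\<close>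
      define \<G>' where "\<G>' = {G \<in> \<G> n. \<exists>V\<in>\<C>. G \<subseteq> V}"
      have "A n \<inter> B \<subseteq> \<Union>\<G>'"
        using A(3)[of n] \<G>(3)[of _ n] unfolding \<G>'_def by blast
      moreover have "closedin X (A n \<inter> B)" "openin X (\<Union>\<G>')"
        using A(1) B \<G>(1) by (auto simp: \<G>'_def)
      ultimately have "\<exists>N. openin X N \<and> A n \<inter> B \<subseteq> N \<and> X closure_of N \<subseteq> \<Union>\<G>'"
        by (intro paracompact_Hausdorff_imp_normal_space[OF X H, unfolded normal_space_alt, rule_format] conjI)
      then obtain N where N: "openin X N" "A n \<inter> B \<subseteq> N" "X closure_of N \<subseteq> \<Union>\<G>'"
        by (elim exE conjE)
      obtain \<psi> where \<psi>: "continuous_map X (top_of_set {0..(1/2::real) ^ n}) \<psi>"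
          "\<psi> ` (topspace X - N) \<subseteq> {0}" "\<psi> ` (A n \<inter> B) \<subseteq> {(1/2) ^ n}"
      proof (rule Urysohn_lemma[OF paracompact_Hausdorff_imp_normal_space[OF X H],
            of "topspace X - N" "A n \<inter> B" 0 "(1/2) ^ n"])
        show "closedin X (topspace X - N)" "closedin X (A n \<inter> B)" "disjnt (topspace X - N) (A n \<inter> B)"
          using N A(1) B by (auto simp: disjnt_def)
        show "0 \<le> (1/2::real) ^ n"
          by simp
      qed (rule that)
      have \<psi>_bound: "0 \<le> \<psi> x \<and> \<psi> x \<le> (1/2) ^ n" if "x \<in> topspace X" for x
        using \<psi>(1) that by (auto simp: continuous_map_in_subtopology)
      obtain \<tau> h where \<tau>:
        "homeomorphic_map (outer_collar X B) (outer_collar X B) \<tau>"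
        "\<And>b. b \<in> B \<Longrightarrow> 0 \<le> h b \<and> h b \<le> \<psi> b \<and> (0 < \<psi> b \<longrightarrow> 0 < h b)"
        "\<And>b s. b \<in> B \<Longrightarrow> s \<le> - h b \<Longrightarrow> \<tau> (b, s) = (b, s + h b)"
      proof (rule disjoint_push[OF B, of \<G>' \<psi> "X closure_of N"])
        show "openin X G" if "G \<in> \<G>'" for G
          using that \<G>(1) by (auto simp: \<G>'_def)
        show "pairwise disjnt \<G>'"
          by (rule pairwise_subset[OF \<G>(2)[of n]]) (auto simp: \<G>'_def)
        show "\<exists>U c. local_collar X B U c \<and> G \<subseteq> c ` (U \<times> {0..<1})" if "G \<in> \<G>'" for G
          using that by (auto simp: \<G>'_def \<C>_def)
        show "continuous_map X euclideanreal \<psi>"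
          using \<psi>(1) by (auto simp: continuous_map_in_subtopology)
        show "0 \<le> \<psi> x \<and> \<psi> x \<le> 1" if "x \<in> topspace X" for x
          using \<psi>_bound[OF that] power_le_one[of "1/2::real" n] by auto
        show "\<psi> x = 0" if "x \<in> topspace X - X closure_of N" for x
          using \<psi>(2) that closure_of_subset[OF openin_subset[OF N(1)]] by blast
      qed (use N(3) in auto)
      have "0 < \<psi> b" if "b \<in> A n" "b \<in> B" for b
        using \<psi>(3) that by (auto simp: image_subset_iff)
      moreover have "\<psi> b \<le> (1/2) ^ n" if "b \<in> B" for b
        using \<psi>_bound[of b] that closedin_subset[OF B] by blast
      ultimately have "pushes n \<tau> h"
        unfolding pushes_def using \<tau> by (meson order_trans)
      then show ?thesis
        by blast
    qed
    then obtain \<tau> h where *: "\<And>n. pushes n (\<tau> n) (h n)"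
      by metis
    have \<tau>: "\<And>n. homeomorphic_map (outer_collar X B) (outer_collar X B) (\<tau> n)"
      and h: "\<And>n b. b \<in> B \<Longrightarrow> 0 \<le> h n b \<and> h n b \<le> (1/2) ^ n"
      and pos: "\<And>n b. b \<in> B \<Longrightarrow> b \<in> A n \<Longrightarrow> 0 < h n b"
      and trans: "\<And>n b s. b \<in> B \<Longrightarrow> s \<le> - h n b \<Longrightarrow> \<tau> n (b, s) = (b, s + h n b)"
      using * unfolding pushes_def by simp_all
    show ?thesis
    proof (rule collared_if_pushes[OF B \<tau> h _ trans])
      fix b
      assume b: "b \<in> B"
      then obtain n where "b \<in> A n"
        using A(2) closedin_subset[OF B] by blast
      then show "\<exists>n. 0 < h n b"
        using pos[OF b] by blast
    qed
  qed
qed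

end
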